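(* Let $V:S^1\to\mathbb{R}$ be of class $C^{k-1,1}(S^1)$ for some integer $k\ge 1$, and let $\phi(\theta)=e^{-V(\theta)}$. Let $\pi_n(z)$ be the monic polynomial of degree $n$ orthogonal with respect to $\phi$ on the unit circle. Then for each fixed integer $p\ge 0$ and each $\rho>1$ there is a constant $K_{p,\rho}>0$ such that \[ \sup_{|z|\ge\rho}\left|\frac{d^p}{dz^p}\left[\pi_n(z)z^{-n}e^{-N(z)}-1\right]\right|\le K_{p,\rho}\frac{\log(n)}{n^{2k}} \] for all sufficiently large $n$.
   Context: $C^{k-1,1}(S^1)$ denotes functions on the circle whose $2\pi$-periodic extension has $k-1$ Lipschitz continuous derivatives. The inner product is $\langle f,g\rangle_\phi=\frac{1}{2\pi}\int_{-\pi}^{\pi}f(\theta)\overline{g(\theta)}\phi(\theta)\,d\theta$, polynomials being evaluated at $z=e^{i\theta}$; $\pi_n$ is the monic degree-$n$ polynomial with $\langle \pi_n,z^j\rangle_\phi=0$ for $0\le j<n$. With Fourier coefficients $V_j=\frac{1}{2\pi}\int_{-\pi}^{\pi}V(\theta)e^{-ij\theta}d\theta$, define $N(z)=\sum_{j=1}^\infty V_{-j}z^{-j}$ for $|z|\ge 1$. *)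

theory Defs
  imports "HOL-Analysis.Analysis" "HOL-Computational_Algebra.Polynomial"
begin

definition C_lip_circle :: "nat \<Rightarrow> (real \<Rightarrow> real) \<Rightarrow> bool" where
  "C_lip_circle k V \<longleftrightarrow>
     (\<forall>x. V (x + 2 * pi) = V x) \<and>
     (\<forall>j < k - 1. \<forall>x. (deriv ^^ j) V differentiable (at x)) \<and>
     (\<exists>L. L-lipschitz_on UNIV ((deriv ^^ (k - 1)) V))"

definition weighted_inner :: "(real \<Rightarrow> real) \<Rightarrow> complex poly \<Rightarrow> complex poly \<Rightarrow> complex" where
  "weighted_inner V p q =
     complex_of_real (1 / (2 * pi)) *
     integral {-pi..pi} (\<lambda>\<theta>. poly p (cis \<theta>) * cnj (poly q (cis \<theta>)) * complex_of_real (exp (- V \<theta>)))"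

definition is_monic_OPUC :: "(real \<Rightarrow> real) \<Rightarrow> nat \<Rightarrow> complex poly \<Rightarrow> bool" where
  "is_monic_OPUC V n p \<longleftrightarrow> degree p = n \<and> lead_coeff p = 1 \<and>
     (\<forall>j < n. weighted_inner V p (monom 1 j) = 0)"

definition fourier_coeff :: "(real \<Rightarrow> real) \<Rightarrow> int \<Rightarrow> complex" where
  "fourier_coeff V j = complex_of_real (1 / (2 * pi)) *
     integral {-pi..pi} (\<lambda>\<theta>. complex_of_real (V \<theta>) * cis (- (real_of_int j * \<theta>)))"

definition N_fun :: "(real \<Rightarrow> real) \<Rightarrow> complex \<Rightarrow> complex" where
  "N_fun V z = (\<Sum>j. fourier_coeff V (- int (Suc j)) / z ^ Suc j)"

end

theory Submission
  imports Defs "HOL-Complex_Analysis.Complex_Analysis"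
begin

text \<open>
  Put \<open>s = 1/z\<close>, \<open>G(s) = N(1/s)\<close> and \<open>Q(s) = s\<^sup>n \<pi>\<^sub>n(1/s)\<close>. On the circle the weight is a constant
  multiple of \<open>|e\<^sup>-\<^sup>G|\<^sup>2\<close>, so orthogonality says that \<open>R = Q e\<^sup>-\<^sup>G - 1\<close> is orthogonal in the unweighted
  \<open>L\<^sup>2\<close> to \<open>p e\<^sup>-\<^sup>G\<close> for every polynomial \<open>p\<close> of degree at most \<open>n\<close> with \<open>p(0) = 0\<close>. Hence the norm of \<open>R\<close>
  is at most that of \<open>T e\<^sup>-\<^sup>G - 1\<close>, where \<open>T\<close> is the Taylor polynomial of \<open>e\<^sup>G\<close> of degree \<open>n\<close>, and this is
  \<open>O(n\<^sup>-\<^sup>k)\<close> because the coefficients \<open>x\<^sub>m\<close> of \<open>e\<^sup>G\<close> inherit from those of \<open>V\<close> the property that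
  \<open>m\<^sup>k x\<^sub>m\<close> is square summable. A duality argument doubles the exponent: the \<open>j\<close>-th Taylor
  coefficient of \<open>R\<close> equals the inner product of \<open>R\<close> with \<open>s\<^sup>j (1 - T\<^sub>n\<^sub>-\<^sub>j e\<^sup>-\<^sup>G)\<close>, a product of two factors of
  size \<open>O(n\<^sup>-\<^sup>k)\<close>. Derivatives are then controlled by Cauchy's inequality.
\<close>

subsection \<open>Weighted square-summability of exponentials of power series\<close>

text \<open>Young's inequality for convolving an l^1 with an l^2 sequence: Cauchy-Schwarz after
  splitting \<open>a i\<close> as \<open>sqrt (a i) * sqrt (a i)\<close> leaves the convolution of
  \<open>a\<close> with the squares of \<open>b\<close>, which is summable as a Cauchy
  product.\<close>

lemma summable_square_convolution:
  fixes a b :: "nat \<Rightarrow> real"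
  assumes a: "\<And>n. 0 \<le> a n" "summable a" and b: "summable (\<lambda>n. (b n)\<^sup>2)"
  shows "summable (\<lambda>m. (\<Sum>i\<le>m. a i * b (m - i))\<^sup>2)"
proof (rule summable_comparison_test)
  have "summable (\<lambda>m. \<Sum>i\<le>m. a i * (b (m - i))\<^sup>2)"
    using summable_Cauchy_product[of a "\<lambda>n. (b n)\<^sup>2"] a b by simp
  then show "summable (\<lambda>m. suminf a * (\<Sum>i\<le>m. a i * (b (m - i))\<^sup>2))"
    by (rule summable_mult)
  show "\<exists>N. \<forall>m\<ge>N. norm ((\<Sum>i\<le>m. a i * b (m - i))\<^sup>2) \<le> suminf a * (\<Sum>i\<le>m. a i * (b (m - i))\<^sup>2)"
  proof (intro exI allI impI)
    fix m
    have "(\<Sum>i\<le>m. a i * b (m - i))\<^sup>2 = (\<Sum>i\<le>m. sqrt (a i) * (sqrt (a i) * b (m - i)))\<^sup>2"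
      using a by (simp flip: mult.assoc)
    also have "\<dots> \<le> (\<Sum>i\<le>m. (sqrt (a i))\<^sup>2) * (\<Sum>i\<le>m. (sqrt (a i) * b (m - i))\<^sup>2)"
      by (rule Cauchy_Schwarz_ineq_sum)
    also have "\<dots> = (\<Sum>i\<le>m. a i) * (\<Sum>i\<le>m. a i * (b (m - i))\<^sup>2)"
      using a by (simp add: power_mult_distrib)
    also have "\<dots> \<le> suminf a * (\<Sum>i\<le>m. a i * (b (m - i))\<^sup>2)"
      using a by (intro mult_right_mono sum_le_suminf sum_nonneg) auto
    finally show "norm ((\<Sum>i\<le>m. a i * b (m - i))\<^sup>2) \<le> suminf a * (\<Sum>i\<le>m. a i * (b (m - i))\<^sup>2)"
      by simp
  qed
qed

text \<open>Cauchy-Schwarz against \<open>1 / n\<close>, in the termwise form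
  \<open>u * v \<le> u^2 + v^2\<close>. This turns the square-summable decay of coefficients into
  absolute convergence.\<close>

lemma summable_if_square_summable_weight:
  fixes b :: "nat \<Rightarrow> real"
  assumes "\<And>n. 0 \<le> b n" "summable (\<lambda>n. (real n * b n)\<^sup>2)"
  shows "summable b"
proof (rule summable_comparison_test)
  have "summable (\<lambda>n. 1 / real n ^ 2)"
    using inverse_power_summable[of 2, where 'a=real] by (simp add: field_simps)
  with assms(2) show "summable (\<lambda>n. (real n * b n)\<^sup>2 + 1 / real n ^ 2)"
    by (rule summable_add)
  have "norm (b n) \<le> (real n * b n)\<^sup>2 + 1 / real n ^ 2" if "n \<ge> 1" for n
  proof -
    have "b n = (real n * b n) * (1 / real n)" using that by simp
    also have "\<dots> \<le> (real n * b n)\<^sup>2 + (1 / real n)\<^sup>2"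
      using sum_squares_bound[of "real n * b n" "1 / real n"] that assms(1)[of n] by simp
    finally show ?thesis using assms(1)[of n] by (simp add: power_divide)
  qed
  then show "\<exists>N. \<forall>n\<ge>N. norm (b n) \<le> (real n * b n)\<^sup>2 + 1 / real n ^ 2" by blast
qed

text \<open>Lets the weight \<open>m ^ k\<close> in a convolution be distributed over the indices
  \<open>i\<close> and \<open>m - i\<close>.\<close>

lemma add_power_le_two_power_mult:
  fixes x y :: real
  assumes "0 \<le> x" "0 \<le> y"
  shows "(x + y) ^ k \<le> 2 ^ k * (x ^ k + y ^ k)"
proof -
  have "(x + y) ^ k \<le> (2 * max x y) ^ k" using assms by (intro power_mono) auto
  also have "\<dots> \<le> 2 ^ k * (x ^ k + y ^ k)"
    using assms by (auto simp: power_mult_distrib max_def)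
  finally show ?thesis .
qed

lemma summable_square_add:
  fixes a b :: "nat \<Rightarrow> real"
  assumes "summable (\<lambda>n. (a n)\<^sup>2)" "summable (\<lambda>n. (b n)\<^sup>2)"
  shows "summable (\<lambda>n. (a n + b n)\<^sup>2)"
proof (rule summable_comparison_test)
  show "summable (\<lambda>n. 2 * ((a n)\<^sup>2 + (b n)\<^sup>2))"
    using assms by (intro summable_mult summable_add)
  have "(x + y)\<^sup>2 \<le> 2 * (x\<^sup>2 + y\<^sup>2)" for x y :: real
    using sum_squares_bound[of x y] by (simp add: power2_sum)
  then show "\<exists>N. \<forall>n\<ge>N. norm ((a n + b n)\<^sup>2) \<le> 2 * ((a n)\<^sup>2 + (b n)\<^sup>2)" by auto
qed

lemma summable_square_mono:
  fixes a b :: "nat \<Rightarrow> real"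
  assumes "summable (\<lambda>n. (b n)\<^sup>2)" "\<And>n. 0 \<le> a n" "\<And>n. a n \<le> b n"
  shows "summable (\<lambda>n. (a n)\<^sup>2)"
  by (rule summable_comparison_test'[OF assms(1)]) (auto intro!: power_mono assms)

text \<open>The bound \<open>1 \<le> j\<close> matters at \<open>n = 0\<close>, where
  \<open>0 ^ 0 = 1\<close>.\<close>

lemma power_le_power_nat_real: "1 \<le> j \<Longrightarrow> j \<le> k \<Longrightarrow> real n ^ j \<le> real n ^ k"
  by (cases "n = 0") (auto simp: power_0_left intro!: power_increasing)

lemma sum_convolution_commute:
  fixes a b :: "nat \<Rightarrow> 'a::comm_semiring_0"
  shows "(\<Sum>i\<le>m. a i * b (m - i)) = (\<Sum>i\<le>m. b i * a (m - i))"
  by (rule sum.reindex_bij_witness[of _ "\<lambda>i. m - i" "\<lambda>i. m - i"]) (auto simp: mult.commute)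

text \<open>The recursion is the one satisfied by the coefficients \<open>x\<close> of an exponential \<open>e\<^sup>g\<close>: it reads \<open>(e\<^sup>g)' = g' e\<^sup>g\<close>.\<close>

lemma weighted_square_summable_log_recursion:
  fixes g x :: "nat \<Rightarrow> real"
  assumes nonneg: "\<And>n. 0 \<le> g n" "\<And>n. 0 \<le> x n"
    and rec: "\<And>m. real m * x m \<le> (\<Sum>i\<le>m. real i * g i * x (m - i))"
    and "summable x" "k \<ge> 1" "summable (\<lambda>j. (real j ^ k * g j)\<^sup>2)"
  shows "summable (\<lambda>m. (real m ^ k * x m)\<^sup>2)"
  using \<open>k \<ge> 1\<close> \<open>summable (\<lambda>j. (real j ^ k * g j)\<^sup>2)\<close>
proof (induction k rule: dec_induct)
  case base
  \<comment> \<open>The right side of \<open>rec\<close> is the convolution of the l^1 sequence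
    \<open>x\<close> with the l^2 sequence \<open>i * g i\<close>.\<close>
  have "summable (\<lambda>m. (\<Sum>i\<le>m. x i * (real (m - i) * g (m - i)))\<^sup>2)"
    using base nonneg \<open>summable x\<close> by (intro summable_square_convolution) auto
  then have "summable (\<lambda>m. (\<Sum>i\<le>m. real i * g i * x (m - i))\<^sup>2)"
    by (subst sum_convolution_commute[of "\<lambda>i. real i * g i"])
  then show ?case
    by (rule summable_square_mono) (use nonneg rec in auto)
next
  case (step k)
  have wk: "summable (\<lambda>j. (real j ^ k * g j)\<^sup>2)"
    by (rule summable_square_mono[OF step.prems])
       (use nonneg step.hyps in \<open>auto intro!: mult_right_mono power_le_power_nat_real simp del: power_Suc\<close>)
  note IH = step.IH[OF wk]
  \<comment> \<open>Here \<open>Suc k \<ge> 2\<close>, so the hypothesis on \<open>g\<close> has a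
    factor \<open>j\<close> to spare, which makes \<open>j * g j\<close> absolutely
    summable.\<close>
  have "summable (\<lambda>j. (real j * (real j * g j))\<^sup>2)"
  proof (rule summable_square_mono[OF step.prems])
    fix j
    have "real j ^ 2 * g j \<le> real j ^ Suc k * g j"
      using nonneg step.hyps by (intro mult_right_mono power_le_power_nat_real) auto
    then show "real j * (real j * g j) \<le> real j ^ Suc k * g j"
      by (simp add: power2_eq_square mult.assoc)
  qed (use nonneg in auto)
  then have l1: "summable (\<lambda>j. real j * g j)"
    by (rule summable_if_square_summable_weight[rotated]) (use nonneg in auto)
  \<comment> \<open>Two convolutions of l^1 with l^2 arise, according to whether the weight falls on
    \<open>x\<close> (\<open>s1\<close>, by the induction hypothesis) or on \<open>g\<close>
    (\<open>s2\<close>, by the hypothesis on \<open>g\<close>).\<close>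
  have s1: "summable (\<lambda>m. (\<Sum>i\<le>m. real i * g i * (real (m - i) ^ k * x (m - i)))\<^sup>2)"
    using nonneg l1 IH by (intro summable_square_convolution) auto
  have "summable (\<lambda>m. (\<Sum>i\<le>m. x i * (real (m - i) ^ Suc k * g (m - i)))\<^sup>2)"
    using nonneg step.prems \<open>summable x\<close> by (intro summable_square_convolution) auto
  then have s2: "summable (\<lambda>m. (\<Sum>i\<le>m. real i ^ Suc k * g i * x (m - i))\<^sup>2)"
    by (subst sum_convolution_commute[of "\<lambda>i. real i ^ Suc k * g i"])
  have s: "summable (\<lambda>m. (2 ^ k * ((\<Sum>i\<le>m. real i ^ Suc k * g i * x (m - i)) +
      (\<Sum>i\<le>m. real i * g i * (real (m - i) ^ k * x (m - i)))))\<^sup>2)"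
    unfolding power_mult_distrib by (intro summable_mult summable_square_add[OF s2 s1])
  show ?case
  proof (rule summable_square_mono[OF s])
    fix m
    show "0 \<le> real m ^ Suc k * x m" using nonneg by simp
    have "real m ^ Suc k * x m = real m ^ k * (real m * x m)" by simp
    also have "\<dots> \<le> real m ^ k * (\<Sum>i\<le>m. real i * g i * x (m - i))"
      by (intro mult_left_mono rec) simp
    also have "\<dots> = (\<Sum>i\<le>m. real m ^ k * (real i * g i * x (m - i)))"
      by (rule sum_distrib_left)
    also have "\<dots> \<le> (\<Sum>i\<le>m. 2 ^ k * (real i ^ k + real (m - i) ^ k) * (real i * g i * x (m - i)))"
    proof (intro sum_mono mult_right_mono)
      fix i assume "i \<in> {..m}"
      then show "real m ^ k \<le> 2 ^ k * (real i ^ k + real (m - i) ^ k)"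
        using add_power_le_two_power_mult[of "real i" "real (m - i)" k] by (simp add: of_nat_diff)
    qed (use nonneg in auto)
    also have "\<dots> = 2 ^ k * ((\<Sum>i\<le>m. real i ^ Suc k * g i * x (m - i)) +
      (\<Sum>i\<le>m. real i * g i * (real (m - i) ^ k * x (m - i))))"
      by (simp add: sum_distrib_left sum.distrib[symmetric] algebra_simps)
    finally show "real m ^ Suc k * x m \<le> \<dots>" .
  qed
qed

text \<open>The \<open>x m\<close> are the Taylor coefficients of \<open>f = exp G\<close> at 0, and
  the recursion compares coefficients in \<open>f' = G' f\<close>. Only the open disc is treated
  here; the boundary circle needs the absolute summability proved in
  \<open>exp_psum_coeffs\<close>.\<close>

lemma exp_power_series_coeffs:
  fixes g :: "nat \<Rightarrow> complex"
  assumes g: "summable (\<lambda>n. norm (g n))" "g 0 = 0"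
  obtains x where "x 0 = 1"
    "\<And>m. of_nat m * x m = (\<Sum>i\<le>m. of_nat i * g i * x (m - i))"
    "\<And>s. norm s < 1 \<Longrightarrow> (\<lambda>m. x m * s ^ m) sums exp (\<Sum>n. g n * s ^ n)"
proof -
  define G where "G = (\<lambda>s. \<Sum>n. g n * s ^ n)"
  define f where "f = (\<lambda>s. exp (G s))"
  define x where "x = (\<lambda>m. (deriv ^^ m) f 0 / fact m)"
  have Gs: "(\<lambda>n. g n * s ^ n) sums G s" if "norm s < 1" for s
    unfolding G_def
  proof (rule summable_sums, rule summable_comparison_test'[OF g(1)])
    show "norm (g n * s ^ n) \<le> norm (g n)" for n
      using that by (simp add: norm_mult norm_power mult_left_le power_le_one)
  qed
  have holG: "G holomorphic_on ball 0 1"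
    using Gs by (intro power_series_holomorphic[of 0 1 g]) auto
  have holf: "f holomorphic_on ball 0 1"
    unfolding f_def by (intro holomorphic_intros holG)
  have fs: "(\<lambda>m. x m * s ^ m) sums f s" if "norm s < 1" for s
    using holomorphic_power_series[OF holf, of s] that by (simp add: x_def)
  have expG: "G has_fps_expansion Abs_fps g"
  proof -
    have "fps_conv_radius (Abs_fps g) \<ge> 1"
      unfolding fps_conv_radius_def
    proof (rule conv_radius_geI_ex)
      fix r :: real assume "0 < r" "ereal r < 1"
      then show "\<exists>z. norm z = r \<and> summable (\<lambda>n. fps_nth (Abs_fps g) n * z ^ n)"
        using Gs[of "of_real r"] by (intro exI[of _ "of_real r"]) (auto simp: sums_iff)
    qed
    then have "fps_conv_radius (Abs_fps g) > 0"
      by (rule less_le_trans[rotated]) simp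
    then show ?thesis
      by (simp add: has_fps_expansion_def eval_fps_def G_def)
  qed
  have expf: "f has_fps_expansion Abs_fps x"
    using has_fps_expansion_fps_expansion[OF _ _ holf]
    by (simp add: fps_expansion_def x_def)
  have "deriv f has_fps_expansion fps_deriv (Abs_fps g) * Abs_fps x"
  proof -
    have "(\<lambda>s. deriv G s * f s) has_fps_expansion fps_deriv (Abs_fps g) * Abs_fps x"
      by (intro has_fps_expansion_mult has_fps_expansion_deriv expG expf)
    moreover have "deriv f s = deriv G s * f s" if "s \<in> ball 0 1" for s
    proof -
      have "(G has_field_derivative deriv G s) (at s)"
        using holG that by (auto intro: holomorphic_derivI)
      then show ?thesis unfolding f_def
        by (intro DERIV_imp_deriv) (auto intro!: derivative_eq_intros)
    qed
    then have "eventually (\<lambda>s. deriv f s = deriv G s * f s) (nhds 0)"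
      by (intro eventually_nhds_in_open[of "ball 0 1", THEN eventually_mono]) auto
    ultimately show ?thesis
      by (subst has_fps_expansion_cong) auto
  qed
  with has_fps_expansion_deriv[OF expf]
  have *: "fps_deriv (Abs_fps x) = fps_deriv (Abs_fps g) * Abs_fps x"
    by (metis fps_expansion_unique_complex)
  have rec: "of_nat m * x m = (\<Sum>i\<le>m. of_nat i * g i * x (m - i))" for m
  proof (cases m)
    case (Suc l)
    \<comment> \<open>Coefficient \<open>l\<close> of the differentiated identity is the recursion
      at index \<open>l + 1\<close>; the term \<open>i = 0\<close> added afterwards has the factor
      0.\<close>
    have "of_nat (Suc l) * x (Suc l) = (\<Sum>i\<le>l. of_nat (Suc i) * g (Suc i) * x (l - i))"
      using arg_cong[OF *, of "\<lambda>F. fps_nth F l"]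
      by (simp add: fps_mult_nth atMost_atLeast0 del: of_nat_Suc)
    then show ?thesis
      unfolding Suc by (subst sum.atMost_Suc_shift) simp
  qed auto
  have "G 0 = 0" using Gs[of 0] g(2) by (simp add: G_def)
  then have "x 0 = 1" by (simp add: x_def f_def)
  from this rec fs[unfolded f_def G_def] show ?thesis by (rule that)
qed

subsection \<open>Absolutely convergent power series on the closed disc\<close>

definition psum :: "(nat \<Rightarrow> complex) \<Rightarrow> complex \<Rightarrow> complex" where
  "psum a s = (\<Sum>n. a n * s ^ n)"

lemma norm_power_series_term_le:
  fixes a s :: complex
  assumes "norm s \<le> 1"
  shows "norm (a * s ^ n) \<le> norm a"
  using assms by (simp add: norm_mult norm_power mult_left_le power_le_one)

lemma summable_norm_psum_terms:
  fixes a :: "nat \<Rightarrow> complex" and s :: complex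
  assumes "summable (\<lambda>n. norm (a n))" "norm s \<le> 1"
  shows "summable (\<lambda>n. norm (a n * s ^ n))"
  by (rule summable_comparison_test'[OF assms(1)])
     (use norm_power_series_term_le[OF assms(2)] in auto)

lemma psum_sums:
  assumes "summable (\<lambda>n. norm (a n))" "norm s \<le> 1"
  shows "(\<lambda>n. a n * s ^ n) sums psum a s"
  unfolding psum_def using summable_norm_psum_terms[OF assms]
  by (rule summable_sums[OF summable_norm_cancel])

lemma continuous_on_psum:
  assumes "summable (\<lambda>n. norm (a n))"
  shows "continuous_on (cball 0 1) (psum a)"
proof -
  have "uniform_limit (cball 0 1) (\<lambda>n s. \<Sum>i<n. a i * s ^ i) (\<lambda>s. \<Sum>i. a i * s ^ i) sequentially"
    by (rule Weierstrass_m_test[OF _ assms]) (simp add: norm_power_series_term_le)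
  then have "continuous_on (cball 0 1) (\<lambda>s. \<Sum>i. a i * s ^ i)"
    by (rule uniform_limit_theorem[rotated]) (auto intro!: always_eventually continuous_intros)
  then show ?thesis by (simp add: psum_def[abs_def])
qed

lemma holomorphic_on_psum:
  assumes "summable (\<lambda>n. norm (a n))"
  shows "psum a holomorphic_on ball 0 1"
  using psum_sums[OF assms] by (intro power_series_holomorphic[of 0 1 a]) auto

lemma psum_mult:
  assumes "summable (\<lambda>n. norm (a n))" "summable (\<lambda>n. norm (b n))" "norm s \<le> 1"
  shows "psum a s * psum b s = psum (\<lambda>m. \<Sum>i\<le>m. a i * b (m - i)) s"
proof -
  have "(\<Sum>i\<le>m. (a i * s ^ i) * (b (m - i) * s ^ (m - i))) = (\<Sum>i\<le>m. a i * b (m - i)) * s ^ m" for m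
    unfolding sum_distrib_right
  proof (rule sum.cong)
    fix i assume "i \<in> {..m}"
    then have "s ^ m = s ^ i * s ^ (m - i)" by (simp flip: power_add)
    then show "(a i * s ^ i) * (b (m - i) * s ^ (m - i)) = a i * b (m - i) * s ^ m"
      by (simp add: mult_ac)
  qed simp
  with Cauchy_product[OF summable_norm_psum_terms[OF assms(1,3)] summable_norm_psum_terms[OF assms(2,3)]]
  show ?thesis by (simp add: psum_def)
qed

lemma summable_norm_convolution:
  fixes a b :: "nat \<Rightarrow> complex"
  assumes "summable (\<lambda>n. norm (a n))" "summable (\<lambda>n. norm (b n))"
  shows "summable (\<lambda>m. norm (\<Sum>i\<le>m. a i * b (m - i)))"
proof (rule summable_comparison_test')
  show "summable (\<lambda>m. \<Sum>i\<le>m. norm (a i) * norm (b (m - i)))"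
    using summable_Cauchy_product[of "\<lambda>n. norm (a n)" "\<lambda>n. norm (b n)"] assms by simp
  show "norm (norm (\<Sum>i\<le>m. a i * b (m - i))) \<le> (\<Sum>i\<le>m. norm (a i) * norm (b (m - i)))" for m
    by (simp add: sum_norm_le norm_mult)
qed

lemma summable_norm_coeff: "summable (\<lambda>n. norm (coeff p n :: complex))"
  by (rule summable_finite[of "{..degree p}"]) (auto simp: coeff_eq_0 not_le)

lemma psum_coeff: "psum (coeff p) s = poly p s"
  unfolding psum_def poly_altdef
  by (rule suminf_finite) (auto simp: coeff_eq_0 not_le)

text \<open>The algebra of absolutely convergent power series is closed under exponentials, which
  carries the identity up to the boundary circle.\<close>

lemma exp_psum_coeffs:
  fixes g :: "nat \<Rightarrow> complex"
  assumes g: "summable (\<lambda>n. norm (g n))" "g 0 = 0"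
  obtains x where "x 0 = 1"
    "\<And>m. of_nat m * x m = (\<Sum>i\<le>m. of_nat i * g i * x (m - i))"
    "summable (\<lambda>n. norm (x n))"
    "\<And>s. norm s \<le> 1 \<Longrightarrow> psum x s = exp (psum g s)"
proof -
  obtain x where x: "x 0 = 1"
    "\<And>m. of_nat m * x m = (\<Sum>i\<le>m. of_nat i * g i * x (m - i))"
    "\<And>s. norm s < 1 \<Longrightarrow> (\<lambda>m. x m * s ^ m) sums exp (psum g s)"
    by (rule exp_power_series_coeffs[OF g, folded psum_def]) blast
  \<comment> \<open>The coefficients \<open>y\<close> of the exponential of the majorant series dominate \<open>x\<close>, and their sum is at most \<open>exp (\<Sum> |g n|)\<close>.\<close>
  define h where "h = (\<lambda>n. complex_of_real (norm (g n)))"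
  obtain y where y: "y 0 = 1"
    "\<And>m. of_nat m * y m = (\<Sum>i\<le>m. of_nat i * h i * y (m - i))"
    "\<And>s. norm s < 1 \<Longrightarrow> (\<lambda>m. y m * s ^ m) sums exp (psum h s)"
  proof (rule exp_power_series_coeffs[of h, folded psum_def])
    show "summable (\<lambda>n. norm (h n))" "h 0 = 0" using g by (auto simp: h_def)
  qed blast
  \<comment> \<open>In the recursion the term \<open>i = 0\<close> vanishes, so only indices
    \<open>m - i < m\<close> occur and strong induction applies.\<close>
  have maj: "\<exists>t\<ge>0. y m = of_real t \<and> norm (x m) \<le> t" for m
  proof (induction m rule: less_induct)
    case (less m)
    show ?case
    proof (cases "m = 0")
      case True
      then show ?thesis using x(1) y(1) by (intro exI[of _ 1]) auto
    next
      case False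
      have "\<forall>l\<in>{..<m}. \<exists>t\<ge>0. y l = of_real t \<and> norm (x l) \<le> t" using less.IH by blast
      then obtain t where t: "\<And>l. l < m \<Longrightarrow> t l \<ge> 0 \<and> y l = of_real (t l) \<and> norm (x l) \<le> t l"
        unfolding bchoice_iff by auto
      define T where "T = (\<Sum>i\<in>{1..m}. real i * norm (g i) * t (m - i))"
      have split: "(\<Sum>i\<le>m. F i) = (\<Sum>i\<in>{1..m}. F i)" if "F 0 = 0" for F :: "nat \<Rightarrow> complex"
        using that by (intro sum.mono_neutral_right) (auto simp: not_le)
      have "of_nat m * y m = of_real T"
        unfolding y(2) T_def of_real_sum
        by (subst split, simp, rule sum.cong) (use t False in \<open>auto simp: h_def\<close>)
      then have 1: "y m = of_real (T / real m)" using False by (simp add: field_simps)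
      have "real m * norm (x m) = norm (of_nat m * x m)" by (simp add: norm_mult)
      also have "\<dots> = norm (\<Sum>i\<in>{1..m}. of_nat i * g i * x (m - i))"
        unfolding x(2) by (subst split) simp_all
      also have "\<dots> \<le> T" unfolding T_def
        by (rule sum_norm_le) (use t False in \<open>auto simp: norm_mult intro!: mult_left_mono\<close>)
      finally have 2: "norm (x m) \<le> T / real m" using False by (simp add: field_simps)
      have "0 \<le> T" unfolding T_def using t False by (intro sum_nonneg) auto
      with 1 2 show ?thesis by (intro exI[of _ "T / real m"]) auto
    qed
  qed
  then obtain t where t: "\<And>m. t m \<ge> 0" "\<And>m. y m = of_real (t m)" "\<And>m. norm (x m) \<le> t m"
    by metis
  define S where "S = (\<Sum>n. norm (g n))"
  \<comment> \<open>The coefficients \<open>t m\<close> are nonnegative, so every partial sum at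
    \<open>r < 1\<close> lies below the full sum, which is the exponential of the majorant series at
    \<open>r\<close>.\<close>
  have ps: "(\<Sum>m<M. t m * r ^ m) \<le> exp S" if r: "0 < r" "r < 1" for M r
  proof -
    have gr: "summable (\<lambda>n. norm (g n) * r ^ n)"
      using summable_norm_psum_terms[OF g(1), of "of_real r"] r by (simp add: norm_mult norm_power)
    have "psum h (of_real r) = of_real (\<Sum>n. norm (g n) * r ^ n)"
      using gr by (simp add: psum_def h_def flip: of_real_power of_real_mult suminf_of_real)
    then have "(\<lambda>m. of_real (t m * r ^ m) :: complex) sums of_real (exp (\<Sum>n. norm (g n) * r ^ n))"
      using y(3)[of "of_real r"] r by (simp add: t exp_of_real)
    then have tr: "(\<lambda>m. t m * r ^ m) sums exp (\<Sum>n. norm (g n) * r ^ n)"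
      by (simp only: sums_of_real_iff)
    then have "(\<Sum>m<M. t m * r ^ m) \<le> exp (\<Sum>n. norm (g n) * r ^ n)"
      using sum_le_suminf[OF sums_summable[OF tr], of "{..<M}"] sums_unique[OF tr] t(1) r by simp
    also have "\<dots> \<le> exp S" unfolding S_def
      using g(1) gr r by (auto intro!: suminf_le mult_left_le power_le_one)
    finally show ?thesis .
  qed
  have "summable t"
  proof (rule summableI_nonneg_bounded)
    fix M
    \<comment> \<open>A finite sum is continuous in \<open>r\<close>, so the bound, uniform in
      \<open>r < 1\<close>, survives at \<open>r = 1\<close>.\<close>
    have "((\<lambda>r. \<Sum>m<M. t m * r ^ m) \<longlongrightarrow> (\<Sum>m<M. t m * 1 ^ m)) (at_left 1)"
      by (intro tendsto_intros)
    moreover have "\<forall>\<^sub>F r in at_left 1. (\<Sum>m<M. t m * r ^ m) \<le> exp S"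
      using ps by (auto simp: eventually_at_left[of 0] intro!: exI[of _ 0])
    ultimately show "(\<Sum>m<M. t m) \<le> exp S"
      using tendsto_upperbound[of "\<lambda>r. \<Sum>m<M. t m * r ^ m" _ "at_left 1"] by simp
  qed (use t in auto)
  then have sx: "summable (\<lambda>n. norm (x n))"
    by (rule summable_comparison_test') (use t in auto)
  have "psum x s = exp (psum g s)" if "norm s \<le> 1" for s
  proof -
    \<comment> \<open>Both sides are continuous on the closed disc and agree in its
      interior.\<close>
    have "psum x s - exp (psum g s) = 0"
    proof (rule continuous_constant_on_closure[of "ball 0 1" "\<lambda>s. psum x s - exp (psum g s)"])
      show "continuous_on (closure (ball 0 1)) (\<lambda>s. psum x s - exp (psum g s))"
        using continuous_on_psum[OF sx] continuous_on_psum[OF g(1)] by (auto intro!: continuous_intros)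
      show "psum x s - exp (psum g s) = 0" if "s \<in> ball 0 1" for s
        using that x(3)[of s] psum_sums[OF sx, of s] by (auto simp: sums_iff psum_def)
    qed (use that in auto)
    then show ?thesis by simp
  qed
  with x(1,2) sx show ?thesis by (rule that)
qed

section \<open>Circle means, coefficient extraction and Parseval's identity\<close>

text \<open>Circle means are taken in \<open>\<theta>\<close>, whereas power series are evaluated at \<open>s = e\<^sup>-\<^sup>i\<^sup>\<theta>\<close>, because \<open>s = 1/z\<close>.\<close>

definition cmean :: "(real \<Rightarrow> complex) \<Rightarrow> complex" where
  "cmean h = of_real (1 / (2 * pi)) * integral {-pi..pi} h"

definition mean_sq :: "(real \<Rightarrow> complex) \<Rightarrow> real" where
  "mean_sq h = 1 / (2 * pi) * integral {-pi..pi} (\<lambda>\<theta>. (norm (h \<theta>))\<^sup>2)"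

lemma cmean_add:
  "f integrable_on {-pi..pi} \<Longrightarrow> g integrable_on {-pi..pi} \<Longrightarrow> cmean (\<lambda>\<theta>. f \<theta> + g \<theta>) = cmean f + cmean g"
  by (simp add: cmean_def integral_add algebra_simps)

lemma cmean_diff:
  "f integrable_on {-pi..pi} \<Longrightarrow> g integrable_on {-pi..pi} \<Longrightarrow> cmean (\<lambda>\<theta>. f \<theta> - g \<theta>) = cmean f - cmean g"
  by (simp add: cmean_def integral_diff algebra_simps)

lemma cmean_cmult: "cmean (\<lambda>\<theta>. c * f \<theta>) = c * cmean f"
  by (simp add: cmean_def)

lemma cmean_sum:
  "finite A \<Longrightarrow> (\<And>i. i \<in> A \<Longrightarrow> f i integrable_on {-pi..pi}) \<Longrightarrow>
    cmean (\<lambda>\<theta>. \<Sum>i\<in>A. f i \<theta>) = (\<Sum>i\<in>A. cmean (f i))"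
  by (simp add: cmean_def integral_sum sum_distrib_left)

lemma cmean_cong: "(\<And>\<theta>. f \<theta> = g \<theta>) \<Longrightarrow> cmean f = cmean g"
  by presburger

lemma cmean_cis: "cmean (\<lambda>\<theta>. cis (of_int m * \<theta>)) = of_bool (m = 0)"
proof (cases "m = 0")
  case False
  have "((\<lambda>\<theta>. cis (of_int m * \<theta>)) has_integral
      (cis (of_int m * pi) / (\<i> * of_int m) - cis (of_int m * (-pi)) / (\<i> * of_int m))) {-pi..pi}"
  proof (rule fundamental_theorem_of_calculus)
    fix x :: real
    have "((\<lambda>\<theta>. exp (\<i> * of_int m * of_real \<theta>)) has_vector_derivative
        (\<i> * of_int m) * exp (\<i> * of_int m * of_real x)) (at x within {-pi..pi})"
    proof -
      have "((\<lambda>z. exp (\<i> * of_int m * z)) has_field_derivative (\<i> * of_int m) * exp (\<i> * of_int m * of_real x)) (at (of_real x))"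
        by (auto intro!: derivative_eq_intros)
      then show ?thesis by (rule has_vector_derivative_real_field)
    qed
    moreover have "exp (\<i> * of_int m * of_real \<theta>) = cis (of_int m * \<theta>)" for \<theta>
      by (simp add: cis_conv_exp mult.assoc)
    ultimately have "((\<lambda>\<theta>. cis (of_int m * \<theta>)) has_vector_derivative (\<i> * of_int m) * cis (of_int m * x)) (at x within {-pi..pi})"
      by simp
    from has_vector_derivative_mult_left[OF this, of "1 / (\<i> * of_int m)"]
    show "((\<lambda>\<theta>. cis (of_int m * \<theta>) / (\<i> * of_int m)) has_vector_derivative cis (of_int m * x)) (at x within {-pi..pi})"
      using False by simp
  qed simp
  moreover have "cis (of_int m * pi) = cis (of_int m * (-pi))"
    by (auto simp: complex_eq_iff sin_zero_iff_int2)
  ultimately show ?thesis using False by (simp add: cmean_def integral_unique)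
qed (simp add: cmean_def scaleR_conv_of_real)

text \<open>The M-test gives uniform convergence, multiplication by the bounded function
  \<open>h\<close> preserves it, and uniform limits may be integrated termwise.\<close>

lemma cmean_mult_series:
  fixes b :: "nat \<Rightarrow> complex" and e :: "nat \<Rightarrow> real \<Rightarrow> complex"
  assumes h: "continuous_on {-pi..pi} h" and b: "summable (\<lambda>n. norm (b n))"
    and e: "\<And>n. continuous_on {-pi..pi} (e n)" "\<And>n \<theta>. norm (e n \<theta>) \<le> 1"
  shows "(\<lambda>n. b n * cmean (\<lambda>\<theta>. h \<theta> * e n \<theta>)) sums cmean (\<lambda>\<theta>. h \<theta> * (\<Sum>n. b n * e n \<theta>))"
proof -
  have ul: "uniform_limit {-pi..pi} (\<lambda>n \<theta>. \<Sum>i<n. b i * e i \<theta>) (\<lambda>\<theta>. \<Sum>i. b i * e i \<theta>) sequentially"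
    by (rule Weierstrass_m_test[OF _ b]) (simp add: norm_mult mult_left_le e)
  have "bounded (h ` {-pi..pi})"
    by (intro compact_imp_bounded compact_continuous_image h) simp
  moreover have "bounded ((\<lambda>\<theta>. \<Sum>i. b i * e i \<theta>) ` {-pi..pi})"
    by (intro compact_imp_bounded compact_continuous_image uniform_limit_theorem[OF _ ul])
       (auto intro!: always_eventually continuous_intros e)
  ultimately have "uniform_limit {-pi..pi} (\<lambda>n \<theta>. h \<theta> * (\<Sum>i<n. b i * e i \<theta>)) (\<lambda>\<theta>. h \<theta> * (\<Sum>i. b i * e i \<theta>)) sequentially"
    by (intro bounded_bilinear.bounded_uniform_limit[OF bounded_bilinear_mult] ul uniform_limit_const)
  then obtain I J where IJ: "\<And>n. ((\<lambda>\<theta>. h \<theta> * (\<Sum>i<n. b i * e i \<theta>)) has_integral I n) {-pi..pi}"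
     "((\<lambda>\<theta>. h \<theta> * (\<Sum>i. b i * e i \<theta>)) has_integral J) {-pi..pi}" "I \<longlonglongrightarrow> J"
    by (rule uniform_limit_integral) (auto intro!: continuous_intros h e)
  have "of_real (1 / (2 * pi)) * I n = (\<Sum>i<n. b i * cmean (\<lambda>\<theta>. h \<theta> * e i \<theta>))" for n
  proof -
    have "of_real (1 / (2 * pi)) * I n = cmean (\<lambda>\<theta>. \<Sum>i<n. b i * (h \<theta> * e i \<theta>))"
      using IJ(1)[of n] by (simp add: cmean_def sum_distrib_left mult_ac integral_unique)
    also have "\<dots> = (\<Sum>i<n. cmean (\<lambda>\<theta>. b i * (h \<theta> * e i \<theta>)))"
      by (rule cmean_sum) (auto intro!: integrable_continuous_interval continuous_intros h e)
    finally show ?thesis by (simp add: cmean_cmult)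
  qed
  moreover have "(\<lambda>n. of_real (1 / (2 * pi)) * I n) \<longlonglongrightarrow> of_real (1 / (2 * pi)) * J"
    by (intro tendsto_intros IJ)
  moreover have "of_real (1 / (2 * pi)) * J = cmean (\<lambda>\<theta>. h \<theta> * (\<Sum>n. b n * e n \<theta>))"
    using IJ(2) by (simp add: cmean_def integral_unique)
  ultimately show ?thesis by (simp add: sums_def)
qed

lemma continuous_on_psum_cis:
  assumes "summable (\<lambda>n. norm (a n))"
  shows "continuous_on S (\<lambda>\<theta>. psum a (cis (- \<theta>)))"
  by (rule continuous_on_compose2[OF continuous_on_psum[OF assms]]) (auto intro!: continuous_intros)

text \<open>The exponent of \<open>cis (real j * \<theta>)\<close> is positive because the series is
  evaluated at \<open>cis (- \<theta>)\<close>: this factor is the conjugate of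
  \<open>s ^ j\<close>.\<close>

lemma cmean_psum:
  assumes "summable (\<lambda>n. norm (a n))"
  shows "cmean (\<lambda>\<theta>. psum a (cis (- \<theta>)) * cis (real j * \<theta>)) = a j"
proof -
  have "(\<lambda>n. a n * cmean (\<lambda>\<theta>. cis (real j * \<theta>) * cis (- \<theta>) ^ n)) sums
      cmean (\<lambda>\<theta>. cis (real j * \<theta>) * (\<Sum>n. a n * cis (- \<theta>) ^ n))"
    using assms by (intro cmean_mult_series) (auto intro!: continuous_intros simp: norm_power)
  moreover have "cis (real j * \<theta>) * cis (- \<theta>) ^ n = cis (of_int (int j - int n) * \<theta>)" for n \<theta>
    unfolding Complex.DeMoivre cis_mult by (simp add: algebra_simps)
  moreover have "(int j - int n = 0) = (n = j)" for n by auto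
  moreover have "cmean (\<lambda>\<theta>. cis (real j * \<theta>) * (\<Sum>n. a n * cis (- \<theta>) ^ n)) =
      cmean (\<lambda>\<theta>. psum a (cis (- \<theta>)) * cis (real j * \<theta>))"
    by (rule cmean_cong) (simp add: psum_def)
  ultimately have "(\<lambda>n. a n * of_bool (n = j)) sums cmean (\<lambda>\<theta>. psum a (cis (- \<theta>)) * cis (real j * \<theta>))"
    by (simp only: cmean_cis)
  moreover have "(\<lambda>n. a n * of_bool (n = j)) sums a j"
    using sums_single[of j a] by (simp add: of_bool_def if_distrib cong: if_cong)
  ultimately show ?thesis using sums_unique2 by blast
qed

lemma cmean_mult_cnj:
  assumes "(\<lambda>\<theta>. (norm (h \<theta>))\<^sup>2) integrable_on {-pi..pi}"
  shows "cmean (\<lambda>\<theta>. h \<theta> * cnj (h \<theta>)) = of_real (mean_sq h)"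
proof -
  have "((\<lambda>\<theta>. complex_of_real ((norm (h \<theta>))\<^sup>2)) has_integral
      of_real (integral {-pi..pi} (\<lambda>\<theta>. (norm (h \<theta>))\<^sup>2))) {-pi..pi}"
    by (intro has_integral_of_real integrable_integral assms)
  then show ?thesis
    by (simp add: cmean_def mean_sq_def integral_unique flip: complex_norm_square)
qed

text \<open>Only the conjugated factor is expanded into its series; \<open>cmean_psum\<close> then
  evaluates each remaining mean.\<close>

lemma parseval_psum:
  assumes "summable (\<lambda>n. norm (a n))"
  shows "(\<lambda>n. (norm (a n))\<^sup>2) sums mean_sq (\<lambda>\<theta>. psum a (cis (- \<theta>)))"
proof -
  have cnj: "cnj (psum a (cis (- \<theta>))) = (\<Sum>n. cnj (a n) * cis (real n * \<theta>))" for \<theta>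
  proof -
    have "(\<lambda>n. cnj (a n * cis (- \<theta>) ^ n)) sums cnj (psum a (cis (- \<theta>)))"
      using psum_sums[OF assms, of "cis (-\<theta>)"] by (simp only: sums_cnj norm_cis)
    then show ?thesis by (simp add: sums_iff Complex.DeMoivre cis_cnj)
  qed
  have "(\<lambda>n. cnj (a n) * cmean (\<lambda>\<theta>. psum a (cis (- \<theta>)) * cis (real n * \<theta>))) sums
      cmean (\<lambda>\<theta>. psum a (cis (- \<theta>)) * (\<Sum>n. cnj (a n) * cis (real n * \<theta>)))"
    using assms by (intro cmean_mult_series continuous_on_psum_cis) (auto intro!: continuous_intros)
  moreover have "(\<lambda>\<theta>. (norm (psum a (cis (- \<theta>))))\<^sup>2) integrable_on {-pi..pi}"
    using assms by (intro integrable_continuous_interval continuous_intros continuous_on_psum_cis)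
  ultimately have "(\<lambda>n. complex_of_real ((norm (a n))\<^sup>2)) sums of_real (mean_sq (\<lambda>\<theta>. psum a (cis (- \<theta>))))"
    unfolding cmean_psum[OF assms] cnj[symmetric]
    by (subst (asm) cmean_mult_cnj) (simp_all only: complex_norm_square mult.commute)
  then show ?thesis by (simp only: sums_of_real_iff)
qed

lemma mean_sq_mono:
  assumes "continuous_on {-pi..pi} f" "continuous_on {-pi..pi} g" "\<And>\<theta>. norm (f \<theta>) \<le> C * norm (g \<theta>)"
  shows "mean_sq f \<le> C\<^sup>2 * mean_sq g"
proof -
  have "integral {-pi..pi} (\<lambda>\<theta>. (norm (f \<theta>))\<^sup>2) \<le> integral {-pi..pi} (\<lambda>\<theta>. C\<^sup>2 * (norm (g \<theta>))\<^sup>2)"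
  proof (rule integral_le)
    show "(norm (f \<theta>))\<^sup>2 \<le> C\<^sup>2 * (norm (g \<theta>))\<^sup>2" for \<theta>
      using assms(3)[of \<theta>] power_mono[of "norm (f \<theta>)" "C * norm (g \<theta>)" 2] by (simp add: power_mult_distrib)
  qed (auto intro!: integrable_continuous_interval continuous_intros assms)
  then show ?thesis by (simp add: mean_sq_def field_simps)
qed

text \<open>Covers every function, since the integral of a non-integrable function has the default
  value 0.\<close>

lemma mean_sq_nonneg: "mean_sq f \<ge> 0"
  unfolding mean_sq_def by (cases "(\<lambda>\<theta>. (norm (f \<theta>))\<^sup>2) integrable_on {-pi..pi}")
    (auto intro!: divide_nonneg_nonneg integral_nonneg simp: not_integrable_integral)

text \<open>The arithmetic-geometric form of Cauchy-Schwarz; it suffices because it is applied to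
  factors of comparable size or where the first term can be absorbed.\<close>

lemma norm_cmean_mult_cnj_le:
  assumes "continuous_on {-pi..pi} f" "continuous_on {-pi..pi} g"
  shows "norm (cmean (\<lambda>\<theta>. f \<theta> * cnj (g \<theta>))) \<le> (mean_sq f + mean_sq g) / 2"
proof -
  have "norm (integral {-pi..pi} (\<lambda>\<theta>. f \<theta> * cnj (g \<theta>))) \<le>
     integral {-pi..pi} (\<lambda>\<theta>. ((norm (f \<theta>))\<^sup>2 + (norm (g \<theta>))\<^sup>2) / 2)"
  proof (rule integral_norm_bound_integral)
    show "norm (f \<theta> * cnj (g \<theta>)) \<le> ((norm (f \<theta>))\<^sup>2 + (norm (g \<theta>))\<^sup>2) / 2" for \<theta>
      using sum_squares_bound[of "norm (f \<theta>)" "norm (g \<theta>)"] by (simp add: norm_mult)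
  qed (auto intro!: integrable_continuous_interval continuous_intros assms)
  also have "\<dots> = (integral {-pi..pi} (\<lambda>\<theta>. (norm (f \<theta>))\<^sup>2) + integral {-pi..pi} (\<lambda>\<theta>. (norm (g \<theta>))\<^sup>2)) / 2"
    by (subst integral_add[symmetric]) (auto intro!: integrable_continuous_interval continuous_intros assms)
  finally show ?thesis by (simp add: cmean_def mean_sq_def norm_divide field_simps)
qed

subsection \<open>Fourier coefficients of periodic functions\<close>

text \<open>The shifted interval is cut at \<open>pi\<close> and the overhang is moved back by one
  period; \<open>h \<le> 2 * pi\<close> puts the cut inside the interval. A negative shift is undone
  by applying the positive case to the shifted function.\<close>

lemma integral_periodic_shift:
  fixes f :: "real \<Rightarrow> complex"
  assumes cont: "continuous_on UNIV f" and per: "\<And>x. f (x + 2 * pi) = f x" and h: "\<bar>h\<bar> \<le> 2 * pi"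
  shows "integral {-pi..pi} (\<lambda>t. f (t + h)) = integral {-pi..pi} f"
proof -
  have main: "integral {-pi..pi} (\<lambda>t. f (t + h)) = integral {-pi..pi} f"
    if cont: "continuous_on UNIV f" and per: "\<And>x. f (x + 2 * pi) = f x" and h: "0 \<le> h" "h \<le> 2 * pi"
    for f :: "real \<Rightarrow> complex" and h
  proof -
    have int: "f integrable_on {a..b}" for a b
      by (intro integrable_continuous_interval continuous_on_subset[OF cont]) simp
    have "integral {-pi..pi} (\<lambda>t. f (t + h)) = integral {-pi+h..pi+h} f"
      using integral_shift_real_ivl[of "-pi+h" h "pi+h" f] by simp
    also have "\<dots> = integral {-pi+h..pi} f + integral {pi..pi+h} f"
      using Henstock_Kurzweil_Integration.integral_combine[of "-pi+h" pi "pi+h" f] h int by simp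
    also have "integral {pi..pi+h} f = integral {-pi..-pi+h} (\<lambda>t. f (t + 2 * pi))"
      using integral_shift_real_ivl[of "pi" "2 * pi" "pi+h" f] by simp
    also have "\<dots> = integral {-pi..-pi+h} f" by (simp add: per)
    also have "integral {-pi+h..pi} f + integral {-pi..-pi+h} f = integral {-pi..pi} f"
      using Henstock_Kurzweil_Integration.integral_combine[of "-pi" "-pi+h" pi f] h int by (simp add: add.commute)
    finally show ?thesis .
  qed
  show ?thesis
  proof (cases "h \<ge> 0")
    case False
    have "integral {-pi..pi} (\<lambda>t. f ((t + (- h)) + h)) = integral {-pi..pi} (\<lambda>t. f (t + h))"
    proof (rule main)
      show "continuous_on UNIV (\<lambda>t. f (t + h))"
        by (rule continuous_on_compose2[OF cont]) (auto intro!: continuous_intros)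
      show "f (x + 2 * pi + h) = f (x + h)" for x
        using per[of "x + h"] by (simp add: algebra_simps)
    qed (use False h in auto)
    then show ?thesis by simp
  qed (use main[OF cont per] h in auto)
qed

text \<open>Combine \<open>v * cos v \<le> sin v\<close> at \<open>v = u / 2\<close> with the
  double-angle formulas; \<open>cos u \<ge> 0\<close> gives
  \<open>2 * (cos (u / 2))^2 \<ge> 1\<close>.\<close>

lemma half_le_sin:
  assumes "0 \<le> u" "u \<le> pi / 2"
  shows "u / 2 \<le> sin u"
proof -
  have *: "v * cos v \<le> sin v" if "0 \<le> v" "v \<le> pi" for v :: real
  proof -
    have "sin 0 - 0 * cos 0 \<le> sin v - v * cos v"
    proof (rule DERIV_nonneg_imp_nondecreasing[OF that(1)])
      fix x assume "0 \<le> x" "x \<le> v"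
      then show "\<exists>y. ((\<lambda>v. sin v - v * cos v) has_real_derivative y) (at x) \<and> 0 \<le> y"
        using that by (intro exI[of _ "x * sin x"]) (auto intro!: derivative_eq_intros mult_nonneg_nonneg sin_ge_zero)
    qed
    then show ?thesis by simp
  qed
  have c: "cos (u / 2) \<ge> 0" using assms by (intro cos_ge_zero) auto
  have "u / 2 \<le> u / 2 * (2 * (cos (u / 2))\<^sup>2)"
  proof -
    have "cos u = 2 * (cos (u / 2))\<^sup>2 - 1" using cos_double_cos[of "u / 2"] by simp
    moreover have "cos u \<ge> 0" using assms by (intro cos_ge_zero) auto
    ultimately have "1 \<le> 2 * (cos (u / 2))\<^sup>2" by simp
    then show ?thesis using mult_left_mono[of 1 "2 * (cos (u / 2))\<^sup>2" "u / 2"] assms by simp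
  qed
  also have "\<dots> = 2 * (u / 2 * cos (u / 2)) * cos (u / 2)" by (simp add: power2_eq_square)
  also have "\<dots> \<le> 2 * sin (u / 2) * cos (u / 2)"
    using *[of "u / 2"] assms c by (intro mult_right_mono) auto
  also have "\<dots> = sin u" using sin_double[of "u / 2"] by simp
  finally show ?thesis .
qed

text \<open>The chord has length \<open>2 * |sin (t / 2)|\<close>. The bound controls the multiplier
  of a difference operator and keeps Chernoff's quotient bounded.\<close>

lemma norm_cis_minus_one_ge:
  assumes "\<bar>t\<bar> \<le> pi"
  shows "\<bar>t\<bar> / 2 \<le> norm (cis t - 1)"
proof -
  have "norm (cis t - 1) = 2 * \<bar>sin (t / 2)\<bar>"
    using dist_exp_i_1[of t] by (simp add: cis_conv_exp)
  moreover have "\<bar>t / 2\<bar> / 2 \<le> \<bar>sin (t / 2)\<bar>"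
    using half_le_sin[of "t / 2"] half_le_sin[of "- t / 2"] assms
    by (cases "t \<ge> 0") auto
  ultimately show ?thesis by simp
qed

text \<open>Expand the nonnegative integral of \<open>|h - S|^2\<close>, where \<open>S\<close> is
  the trigonometric polynomial with the Fourier coefficients of \<open>h\<close>. Integrability
  rather than continuity of \<open>h\<close> is assumed because Chernoff's quotient may be
  discontinuous at 0.\<close>

lemma bessel_inequality:
  fixes h :: "real \<Rightarrow> complex" and A :: "int set"
  assumes int: "\<And>j::int. (\<lambda>\<theta>. h \<theta> * cis (- (of_int j * \<theta>))) integrable_on {-pi..pi}"
    and int2: "(\<lambda>\<theta>. (norm (h \<theta>))\<^sup>2) integrable_on {-pi..pi}" and "finite A"
  shows "(\<Sum>j\<in>A. (norm (cmean (\<lambda>\<theta>. h \<theta> * cis (- (of_int j * \<theta>)))))\<^sup>2) \<le> mean_sq h"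
proof -
  define c where "c = (\<lambda>j::int. cmean (\<lambda>\<theta>. h \<theta> * cis (- (of_int j * \<theta>))))"
  define S where "S = (\<lambda>\<theta>. \<Sum>j\<in>A. c j * cis (of_int j * \<theta>))"
  define s where "s = (\<Sum>j\<in>A. (norm (c j))\<^sup>2)"
  have hi: "(f has_integral (of_real (2 * pi) * cmean f)) {-pi..pi}" if "f integrable_on {-pi..pi}" for f
    using that by (simp add: cmean_def has_integral_iff)
  have sc: "complex_of_real s = (\<Sum>j\<in>A. cnj (c j) * c j)"
    by (simp add: s_def of_real_sum complex_norm_square mult.commute del: of_real_power)
  have cnjS: "cnj (S \<theta>) = (\<Sum>j\<in>A. cnj (c j) * cis (- (of_int j * \<theta>)))" for \<theta>
    by (simp add: S_def cis_cnj)
  have "((\<lambda>\<theta>. \<Sum>j\<in>A. cnj (c j) * (h \<theta> * cis (- (of_int j * \<theta>)))) has_integral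
      (\<Sum>j\<in>A. cnj (c j) * (of_real (2 * pi) * c j))) {-pi..pi}"
    unfolding c_def using \<open>finite A\<close>
    by (intro has_integral_sum has_integral_mult_right hi int)
  moreover have "(\<Sum>j\<in>A. cnj (c j) * (of_real (2 * pi) * c j)) = of_real (2 * pi * s)"
    by (simp add: sc sum_distrib_left mult_ac)
  moreover have "(\<lambda>\<theta>. \<Sum>j\<in>A. cnj (c j) * (h \<theta> * cis (- (of_int j * \<theta>)))) = (\<lambda>\<theta>. h \<theta> * cnj (S \<theta>))"
    by (simp add: cnjS sum_distrib_left mult_ac)
  \<comment> \<open>The mixed term \<open>I1\<close> and the square term \<open>I2\<close> have the
    same value, so the expansion collapses to the integral of \<open>|h|^2\<close> minus
    \<open>2 * pi * s\<close>.\<close>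
  ultimately have I1: "((\<lambda>\<theta>. h \<theta> * cnj (S \<theta>)) has_integral of_real (2 * pi * s)) {-pi..pi}" by simp
  have ci: "((\<lambda>\<theta>. cis (of_int m * \<theta>)) has_integral (of_real (2 * pi) * of_bool (m = 0))) {-pi..pi}" for m
    unfolding cmean_cis[symmetric] by (intro hi integrable_continuous_interval continuous_intros)
  have "((\<lambda>\<theta>. \<Sum>i\<in>A. \<Sum>j\<in>A. (c i * cnj (c j)) * cis (of_int (i - j) * \<theta>)) has_integral
      (\<Sum>i\<in>A. \<Sum>j\<in>A. (c i * cnj (c j)) * (of_real (2 * pi) * of_bool (i - j = 0)))) {-pi..pi}"
    using \<open>finite A\<close> by (intro has_integral_sum has_integral_mult_right ci)
  moreover have "(\<Sum>i\<in>A. \<Sum>j\<in>A. (c i * cnj (c j)) * (of_real (2 * pi) * of_bool (i - j = 0))) = of_real (2 * pi * s)"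
  proof -
    have "(\<Sum>j\<in>A. (c i * cnj (c j)) * (of_real (2 * pi) * of_bool (i - j = 0))) = of_real (2 * pi) * (cnj (c i) * c i)"
      if "i \<in> A" for i
      using sum.delta'[OF \<open>finite A\<close>, of i "\<lambda>j. c i * cnj (c j) * of_real (2 * pi)"] that
      by (simp add: of_bool_def if_distrib mult_ac cong: if_cong)
    then show ?thesis by (simp add: sc sum_distrib_left)
  qed
  moreover have "(\<Sum>i\<in>A. \<Sum>j\<in>A. (c i * cnj (c j)) * cis (of_int (i - j) * \<theta>)) = S \<theta> * cnj (S \<theta>)" for \<theta>
  proof -
    have "cis (of_int (i - j) * \<theta>) = cis (of_int i * \<theta>) * cis (- (of_int j * \<theta>))" for i j
      by (simp add: cis_mult algebra_simps)
    then show ?thesis unfolding cnjS unfolding S_def sum_product by (simp add: mult_ac)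
  qed
  ultimately have I2: "((\<lambda>\<theta>. S \<theta> * cnj (S \<theta>)) has_integral of_real (2 * pi * s)) {-pi..pi}" by simp
  define K where "K = integral {-pi..pi} (\<lambda>\<theta>. (norm (h \<theta>))\<^sup>2)"
  have "((\<lambda>\<theta>. (norm (h \<theta>))\<^sup>2 - 2 * Re (h \<theta> * cnj (S \<theta>)) + Re (S \<theta> * cnj (S \<theta>))) has_integral
     (K - 2 * Re (of_real (2 * pi * s)) + Re (of_real (2 * pi * s)))) {-pi..pi}"
    unfolding K_def
    by (intro has_integral_add has_integral_diff has_integral_mult_right has_integral_Re I1 I2 integrable_integral int2)
  then have "0 \<le> K - 2 * Re (of_real (2 * pi * s)) + Re (of_real (2 * pi * s))"
  proof (rule has_integral_nonneg)
    fix \<theta>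
    have "(norm (h \<theta> - S \<theta>))\<^sup>2 = (norm (h \<theta>))\<^sup>2 - 2 * Re (h \<theta> * cnj (S \<theta>)) + Re (S \<theta> * cnj (S \<theta>))"
      unfolding cmod_power2 by (simp add: power2_eq_square algebra_simps)
    then show "0 \<le> (norm (h \<theta>))\<^sup>2 - 2 * Re (h \<theta> * cnj (S \<theta>)) + Re (S \<theta> * cnj (S \<theta>))"
      by (metis zero_le_power2)
  qed
  then have "s \<le> K / (2 * pi)" by (simp add: field_simps)
  then show ?thesis by (simp add: s_def K_def c_def mean_sq_def)
qed

lemma fourier_coeff_eq_cmean:
  "fourier_coeff f j = cmean (\<lambda>\<theta>. complex_of_real (f \<theta>) * cis (- (real_of_int j * \<theta>)))"
  by (simp add: fourier_coeff_def cmean_def)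

lemma fourier_coeff_uminus: "fourier_coeff f (- j) = cnj (fourier_coeff f j)"
proof -
  have "cnj (integral {-pi..pi} (\<lambda>\<theta>. complex_of_real (f \<theta>) * cis (- (real_of_int j * \<theta>)))) =
     integral {-pi..pi} (\<lambda>\<theta>. cnj (complex_of_real (f \<theta>) * cis (- (real_of_int j * \<theta>))))"
    by (rule integral_cnj)
  then show ?thesis by (simp add: fourier_coeff_def cis_cnj)
qed

lemma fourier_coeff_shift:
  assumes cont: "continuous_on UNIV f" and per: "\<And>x. f (x + 2 * pi) = f x" and x: "\<bar>x\<bar> \<le> 2 * pi"
  shows "fourier_coeff (\<lambda>t. f (t + x)) j = fourier_coeff f j * cis (real_of_int j * x)"
proof -
  have "cmean (\<lambda>t. of_real (f (t + x)) * cis (- (real_of_int j * (t + x)))) = fourier_coeff f j"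
    unfolding fourier_coeff_eq_cmean cmean_def
  proof (subst integral_periodic_shift)
    show "continuous_on UNIV (\<lambda>t. complex_of_real (f t) * cis (- (real_of_int j * t)))"
      by (intro continuous_intros cont)
    have "cis (- (real_of_int j * (t + 2 * pi))) = cis (- (real_of_int j * t)) * cis (2 * pi * of_int (- j))" for t
      unfolding cis_mult by (simp add: algebra_simps)
    then show "complex_of_real (f (t + 2 * pi)) * cis (- (real_of_int j * (t + 2 * pi))) =
        complex_of_real (f t) * cis (- (real_of_int j * t))" for t
      by (simp add: per cis_multiple_2pi del: of_int_minus)
  qed (use x in auto)
  moreover have "complex_of_real (f (t + x)) * cis (- (real_of_int j * t)) =
      cis (real_of_int j * x) * (complex_of_real (f (t + x)) * cis (- (real_of_int j * (t + x))))" for t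
    unfolding mult.left_commute[of "cis _" "of_real _"] cis_mult by (simp add: algebra_simps)
  then have "fourier_coeff (\<lambda>t. f (t + x)) j =
      cmean (\<lambda>t. cis (real_of_int j * x) * (complex_of_real (f (t + x)) * cis (- (real_of_int j * (t + x)))))"
    unfolding fourier_coeff_eq_cmean by (rule cmean_cong)
  ultimately show ?thesis by (simp add: cmean_cmult)
qed

text \<open>Bessel's inequality for the difference \<open>f(t + h) - f(t)\<close> with \<open>h = 1/M\<close>.\<close>

lemma lipschitz_fourier_coeff_bound:
  assumes lip: "L-lipschitz_on UNIV f" and per: "\<And>x. f (x + 2 * pi) = f x"
  shows "(\<Sum>j\<in>{1..M}. (real j * norm (fourier_coeff f (int j)))\<^sup>2) \<le> 4 * L\<^sup>2"
proof (cases "M = 0")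
  case False
  \<comment> \<open>With this scale \<open>j * h \<le> 1\<close> for all \<open>j \<le> M\<close>,
    so \<open>|cis (j * h) - 1| \<ge> j * h / 2\<close>: the factor \<open>j\<close> can be bought
    at the price \<open>2 / h\<close>.\<close>
  define h where "h = 1 / real M"
  have h: "0 < h" "h \<le> 1" using False by (auto simp: h_def)
  have cont: "continuous_on UNIV f" using lip by (rule lipschitz_on_continuous_on)
  have cont': "continuous_on UNIV (\<lambda>t. f (t + h))"
    by (rule continuous_on_compose2[OF cont]) (auto intro!: continuous_intros)
  define D where "D = (\<lambda>t. complex_of_real (f (t + h) - f t))"
  have contD: "continuous_on S D" for S
    unfolding D_def
    by (intro continuous_intros continuous_on_subset[OF cont] continuous_on_subset[OF cont']) auto
  have Dj: "cmean (\<lambda>t. D t * cis (- (real_of_int j * t))) = (cis (real_of_int j * h) - 1) * fourier_coeff f j" for j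
  proof -
    have "cmean (\<lambda>t. D t * cis (- (real_of_int j * t))) =
       fourier_coeff (\<lambda>t. f (t + h)) j - fourier_coeff f j"
      unfolding fourier_coeff_eq_cmean D_def of_real_diff left_diff_distrib
      by (intro cmean_diff integrable_continuous_interval continuous_intros
            continuous_on_subset[OF cont] continuous_on_subset[OF cont']) auto
    also have "fourier_coeff (\<lambda>t. f (t + h)) j = fourier_coeff f j * cis (real_of_int j * h)"
      using h pi_gt3 by (intro fourier_coeff_shift cont per) auto
    finally show ?thesis by (simp add: algebra_simps)
  qed
  have "mean_sq D \<le> (L * h)\<^sup>2 * mean_sq (\<lambda>_. 1)"
  proof (rule mean_sq_mono)
    show "norm (D t) \<le> L * h * norm (1::complex)" for t
      using lipschitz_onD[OF lip, of "t + h" t] h by (simp add: D_def dist_real_def del: of_real_diff)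
  qed (auto intro: contD)
  moreover have "mean_sq (\<lambda>_. 1) = 1" by (simp add: mean_sq_def)
  ultimately have DL: "mean_sq D \<le> (L * h)\<^sup>2" by simp
  have "(\<Sum>j\<in>{1..M}. (real j * norm (fourier_coeff f (int j)))\<^sup>2) \<le>
     (\<Sum>j\<in>{1..M}. (2 / h)\<^sup>2 * (norm (cmean (\<lambda>t. D t * cis (- (real_of_int (int j) * t)))))\<^sup>2)"
  proof (rule sum_mono)
    fix j assume j: "j \<in> {1..M}"
    then have "real j * h \<le> 1" using False by (simp add: h_def)
    then have "\<bar>real j * h\<bar> / 2 \<le> norm (cis (real j * h) - 1)"
      using h pi_gt3 by (intro norm_cis_minus_one_ge) auto
    then have "real j \<le> 2 / h * norm (cis (real j * h) - 1)" using h by (simp add: field_simps)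
    then have "(real j * norm (fourier_coeff f (int j)))\<^sup>2 \<le>
       (2 / h * norm (cis (real j * h) - 1) * norm (fourier_coeff f (int j)))\<^sup>2"
      by (intro power_mono mult_right_mono) auto
    then show "(real j * norm (fourier_coeff f (int j)))\<^sup>2 \<le>
       (2 / h)\<^sup>2 * (norm (cmean (\<lambda>t. D t * cis (- (real_of_int (int j) * t)))))\<^sup>2"
      unfolding Dj by (simp add: norm_mult power_mult_distrib power_divide mult_ac)
  qed
  also have "\<dots> = (2 / h)\<^sup>2 * (\<Sum>j\<in>int ` {1..M}. (norm (cmean (\<lambda>t. D t * cis (- (real_of_int j * t)))))\<^sup>2)"
    by (simp add: sum_distrib_left sum.reindex)
  also have "\<dots> \<le> (2 / h)\<^sup>2 * mean_sq D"
    by (intro mult_left_mono bessel_inequality)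
       (auto intro!: integrable_continuous_interval continuous_intros contD)
  \<comment> \<open>The Lipschitz bound on the difference contributes exactly the power of
    \<open>h\<close> that cancels the price, so the result does not depend on
    \<open>M\<close>.\<close>
  also have "\<dots> \<le> (2 / h)\<^sup>2 * (L * h)\<^sup>2" by (intro mult_left_mono DL) auto
  also have "\<dots> = 4 * L\<^sup>2" using h by (simp add: power_mult_distrib power_divide)
  finally show ?thesis .
qed simp

section \<open>Decay of Fourier coefficients from smoothness\<close>

lemma fourier_coeff_deriv:
  assumes per: "\<And>x. f (x + 2 * pi) = f x" and diff: "\<And>x. f differentiable (at x)"
    and cont: "continuous_on UNIV (deriv f)"
  shows "fourier_coeff (deriv f) j = \<i> * of_int j * fourier_coeff f j"
proof -
  have contf: "continuous_on S f" for S
    using diff by (meson differentiable_imp_continuous_on differentiable_on_def differentiable_at_withinI)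
  \<comment> \<open>Integration by parts, written as the fundamental theorem for the product of
    \<open>f\<close> with the character; the boundary values cancel by periodicity.\<close>
  have "((\<lambda>t. of_real (deriv f t) * cis (- (of_int j * t)) + of_real (f t) * ((- \<i> * of_int j) * cis (- (of_int j * t))))
     has_integral (of_real (f pi) * cis (- (of_int j * pi)) - of_real (f (-pi)) * cis (- (of_int j * (-pi))))) {-pi..pi}"
  proof (rule fundamental_theorem_of_calculus)
    fix t :: real
    have "(f has_vector_derivative deriv f t) (at t within {-pi..pi})"
      using diff[of t] by (metis DERIV_deriv_iff_real_differentiable has_real_derivative_iff_has_vector_derivative has_vector_derivative_at_within)
    then have 1: "((\<lambda>t. complex_of_real (f t)) has_vector_derivative complex_of_real (deriv f t)) (at t within {-pi..pi})"
      by (rule bounded_linear.has_vector_derivative[OF bounded_linear_of_real])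
    have "((\<lambda>z. exp (- \<i> * of_int j * z)) has_field_derivative (- \<i> * of_int j) * exp (- \<i> * of_int j * of_real t)) (at (of_real t))"
      by (auto intro!: derivative_eq_intros)
    then have "((\<lambda>t. exp (- \<i> * of_int j * of_real t)) has_vector_derivative (- \<i> * of_int j) * exp (- \<i> * of_int j * of_real t)) (at t within {-pi..pi})"
      by (rule has_vector_derivative_real_field)
    moreover have "exp (- \<i> * of_int j * of_real t) = cis (- (of_int j * t))" for t
      by (simp add: cis_conv_exp mult.assoc)
    ultimately have 2: "((\<lambda>t. cis (- (of_int j * t))) has_vector_derivative (- \<i> * of_int j) * cis (- (of_int j * t))) (at t within {-pi..pi})"
      by simp
    from has_vector_derivative_mult[OF 1 2]
    show "((\<lambda>t. complex_of_real (f t) * cis (- (of_int j * t))) has_vector_derivative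
       of_real (deriv f t) * cis (- (of_int j * t)) + of_real (f t) * ((- \<i> * of_int j) * cis (- (of_int j * t)))) (at t within {-pi..pi})"
      by (simp add: add.commute)
  qed simp
  moreover have "f pi = f (-pi)" using per[of "-pi"] by simp
  moreover have "cis (- (of_int j * pi)) = cis (- (of_int j * (-pi)))"
    by (auto simp: complex_eq_iff sin_zero_iff_int2)
  ultimately have "cmean (\<lambda>t. of_real (deriv f t) * cis (- (of_int j * t)) + (- \<i> * of_int j) * (of_real (f t) * cis (- (of_int j * t)))) = 0"
    by (simp add: cmean_def integral_unique mult_ac)
  then have "fourier_coeff (deriv f) j + (- \<i> * of_int j) * fourier_coeff f j = 0"
    unfolding fourier_coeff_eq_cmean
    by (subst (asm) cmean_add)
       (auto intro!: integrable_continuous_interval continuous_intros contf continuous_on_subset[OF cont]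
         simp flip: cmean_cmult)
  then show ?thesis by (simp add: algebra_simps)
qed

text \<open>The possible derivatives at \<open>x + p\<close> and at \<open>x\<close> are the same,
  so the choice operator behind \<open>deriv\<close> returns the same value, even where none
  exists.\<close>

lemma deriv_periodic:
  fixes f :: "real \<Rightarrow> real"
  assumes "\<And>x. f (x + p) = f x"
  shows "deriv f (x + p) = deriv f x"
proof -
  have "(\<lambda>t. f (t + p)) = f" using assms by auto
  then have "(f has_real_derivative D) (at (x + p)) \<longleftrightarrow> (f has_real_derivative D) (at x)" for D
    using DERIV_shift[of f D x p] by (simp add: add.commute)
  then show ?thesis by (simp add: deriv_def)
qed

lemma C_lip_circle_continuous_deriv:
  assumes V: "C_lip_circle k V" and "i \<le> k - 1"
  shows "continuous_on UNIV ((deriv ^^ i) V)"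
proof (cases "i = k - 1")
  case True
  then show ?thesis using V unfolding C_lip_circle_def by (auto intro: lipschitz_on_continuous_on)
next
  case False
  then have "(deriv ^^ i) V differentiable (at x)" for x
    using assms unfolding C_lip_circle_def by auto
  then show ?thesis
    by (meson differentiable_imp_continuous_on differentiable_on_def differentiable_at_withinI)
qed

text \<open>Periodicity is carried through the induction because every further integration by parts
  needs it.\<close>

lemma C_lip_circle_iterated_deriv:
  assumes V: "C_lip_circle k V" and "i \<le> k - 1"
  shows "(\<forall>x. (deriv ^^ i) V (x + 2 * pi) = (deriv ^^ i) V x) \<and>
     (\<forall>j. fourier_coeff ((deriv ^^ i) V) j = (\<i> * of_int j) ^ i * fourier_coeff V j)"
  using \<open>i \<le> k - 1\<close>
proof (induction i)
  case 0
  then show ?case using V by (auto simp: C_lip_circle_def)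
next
  case (Suc i)
  have IH: "\<And>x. (deriv ^^ i) V (x + 2 * pi) = (deriv ^^ i) V x"
    "\<And>j. fourier_coeff ((deriv ^^ i) V) j = (\<i> * of_int j) ^ i * fourier_coeff V j"
    using Suc by auto
  have "fourier_coeff (deriv ((deriv ^^ i) V)) j = \<i> * of_int j * fourier_coeff ((deriv ^^ i) V) j" for j
  proof (rule fourier_coeff_deriv)
    show "(deriv ^^ i) V (x + 2 * pi) = (deriv ^^ i) V x" for x by (rule IH(1))
    show "(deriv ^^ i) V differentiable (at x)" for x
      using V Suc.prems unfolding C_lip_circle_def by auto
    show "continuous_on UNIV (deriv ((deriv ^^ i) V))"
      using C_lip_circle_continuous_deriv[OF V Suc.prems] by simp
  qed
  moreover have "deriv ((deriv ^^ i) V) (x + 2 * pi) = deriv ((deriv ^^ i) V) x" for x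
    by (rule deriv_periodic) (rule IH(1))
  ultimately show ?case using IH(2) by (simp add: mult_ac)
qed

text \<open>Of the \<open>k\<close> factors \<open>j\<close>, the derivatives supply
  \<open>k - 1\<close> and the Lipschitz condition on the last derivative supplies one more, in the
  square-summable sense.\<close>

lemma C_lip_circle_coeff_summable:
  assumes V: "C_lip_circle k V" and "k \<ge> 1"
  shows "summable (\<lambda>j. (real j ^ k * norm (fourier_coeff V (- int j)))\<^sup>2)"
proof -
  define W where "W = (deriv ^^ (k - 1)) V"
  obtain L where L: "L-lipschitz_on UNIV W" using V by (auto simp: C_lip_circle_def W_def)
  have W: "\<And>x. W (x + 2 * pi) = W x" "\<And>j. fourier_coeff W j = (\<i> * of_int j) ^ (k - 1) * fourier_coeff V j"
    using C_lip_circle_iterated_deriv[OF V, of "k - 1"] by (auto simp: W_def)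
  have eq: "real j ^ k * norm (fourier_coeff V (- int j)) = real j * norm (fourier_coeff W (int j))" for j
  proof -
    have "norm (fourier_coeff V (- int j)) = norm (fourier_coeff V (int j))"
      by (simp add: fourier_coeff_uminus)
    moreover have "real j ^ k = real j * real j ^ (k - 1)"
      using \<open>k \<ge> 1\<close> by (cases k) auto
    ultimately show ?thesis by (simp add: W norm_mult norm_power)
  qed
  show ?thesis unfolding eq
  proof (rule summableI_nonneg_bounded)
    fix M
    have "(\<Sum>j<M. (real j * norm (fourier_coeff W (int j)))\<^sup>2) \<le> (\<Sum>j\<in>insert 0 {1..M}. (real j * norm (fourier_coeff W (int j)))\<^sup>2)"
      by (intro sum_mono2) auto
    also have "\<dots> = (\<Sum>j\<in>{1..M}. (real j * norm (fourier_coeff W (int j)))\<^sup>2)" by simp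
    also have "\<dots> \<le> 4 * L\<^sup>2" by (rule lipschitz_fourier_coeff_bound[OF L W(1)])
    finally show "(\<Sum>j<M. (real j * norm (fourier_coeff W (int j)))\<^sup>2) \<le> 4 * L\<^sup>2" .
  qed simp
qed

text \<open>Provides the local condition for pointwise convergence of the Fourier series: for
  \<open>k = 1\<close> it is the hypothesis itself, for larger \<open>k\<close> the continuous
  derivative is bounded on a compact interval.\<close>

lemma C_lip_circle_lipschitz_at:
  assumes V: "C_lip_circle k V" and "k \<ge> 1"
  obtains C where "\<And>t. \<bar>t\<bar> \<le> pi \<Longrightarrow> \<bar>V (x + t) - V x\<bar> \<le> C * \<bar>t\<bar>"
proof (cases "k = 1")
  case True
  then obtain L where "L-lipschitz_on UNIV V" using V by (auto simp: C_lip_circle_def)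
  then have "\<bar>V (x + t) - V x\<bar> \<le> L * \<bar>t\<bar>" for t
    using lipschitz_onD[of L UNIV V "x + t" x] by (simp add: dist_real_def)
  then show ?thesis by (rule that)
next
  case False
  then have k: "k \<ge> 2" using \<open>k \<ge> 1\<close> by simp
  have diff: "V differentiable (at y)" for y
  proof -
    have "\<forall>j<k - 1. \<forall>x. (deriv ^^ j) V differentiable (at x)" using V by (simp add: C_lip_circle_def)
    then have "(deriv ^^ 0) V differentiable (at y)" using k by fastforce
    then show ?thesis by simp
  qed
  have "continuous_on UNIV (deriv V)"
    using C_lip_circle_continuous_deriv[OF V, of 1] k by simp
  then have "bounded (deriv V ` {x - pi..x + pi})"
    by (intro compact_imp_bounded compact_continuous_image) (auto intro: continuous_on_subset)
  then obtain C where C: "\<And>y. y \<in> {x - pi..x + pi} \<Longrightarrow> norm (deriv V y) \<le> C"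
    unfolding bounded_iff by blast
  have "norm (V (x + t) - V x) \<le> C * norm ((x + t) - x)" if "\<bar>t\<bar> \<le> pi" for t
  proof (rule field_differentiable_bound[of "{x - pi..x + pi}"])
    show "(V has_field_derivative deriv V y) (at y within {x - pi..x + pi})" for y
      using diff[of y] by (metis DERIV_deriv_iff_real_differentiable has_field_derivative_at_within)
  qed (use C that in auto)
  then have "\<bar>V (x + t) - V x\<bar> \<le> C * \<bar>t\<bar>" if "\<bar>t\<bar> \<le> pi" for t using that by simp
  then show ?thesis by (rule that)
qed

subsection \<open>Pointwise convergence and the Szego factorisation\<close>

text \<open>Chernoff's proof: dividing \<open>f(x + t) - f(x)\<close> by \<open>e\<^sup>i\<^sup>t - 1\<close> makes the Fourier partial sums telescope.\<close>

lemma fourier_series_converges: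
  assumes cont: "continuous_on UNIV f" and per: "\<And>y. f (y + 2 * pi) = f y" and x: "\<bar>x\<bar> \<le> 2 * pi"
    and lip: "\<And>t. \<bar>t\<bar> \<le> pi \<Longrightarrow> \<bar>f (x + t) - f x\<bar> \<le> C * \<bar>t\<bar>"
  shows "(\<lambda>M. \<Sum>j\<in>{-int M..int M}. fourier_coeff f j * cis (real_of_int j * x)) \<longlonglongrightarrow> of_real (f x)"
proof -
  \<comment> \<open>At \<open>t = 0\<close> the quotient is \<open>0 / 0\<close>, with value 0; on
    \<open>{-pi..pi}\<close> this is the only zero of the denominator.\<close>
  define g where "g = (\<lambda>t. complex_of_real (f (x + t) - f x) / (cis t - 1))"
  have contx: "continuous_on UNIV (\<lambda>t. f (x + t))"
    by (rule continuous_on_compose2[OF cont]) (auto intro!: continuous_intros)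
  have meas: "g \<in> borel_measurable borel"
    unfolding g_def
    by (intro borel_measurable_divide borel_measurable_continuous_onI continuous_intros contx)
  have bound: "norm (g t) \<le> 2 * \<bar>C\<bar>" if "t \<in> {-pi..pi}" for t
  proof (cases "t = 0")
    case False
    have t: "\<bar>t\<bar> \<le> pi" using that by auto
    have "norm (cis t - 1) > 0" using norm_cis_minus_one_ge[OF t] False by linarith
    moreover have "\<bar>f (x + t) - f x\<bar> \<le> 2 * \<bar>C\<bar> * norm (cis t - 1)"
    proof -
      have "\<bar>f (x + t) - f x\<bar> \<le> C * \<bar>t\<bar>" by (rule lip[OF t])
      also have "\<dots> \<le> \<bar>C\<bar> * (2 * norm (cis t - 1))"
        using norm_cis_minus_one_ge[OF t] by (intro mult_mono) auto
      finally show ?thesis by simp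
    qed
    ultimately show ?thesis unfolding g_def by (simp add: norm_divide divide_le_eq del: of_real_diff)
  qed (simp add: g_def)
  \<comment> \<open>The quotient may be discontinuous at 0, so integrability comes from
    measurability and boundedness.\<close>
  have intg: "(\<lambda>t. g t * cis (- (real_of_int j * t))) integrable_on {-pi..pi}" for j
  proof (rule measurable_bounded_by_integrable_imp_integrable)
    have "(\<lambda>t. g t * cis (- (real_of_int j * t))) \<in> borel_measurable borel"
      by (intro borel_measurable_times meas borel_measurable_continuous_onI continuous_intros)
    then show "(\<lambda>t. g t * cis (- (real_of_int j * t))) \<in> borel_measurable (lebesgue_on {-pi..pi})"
      by (intro measurable_restrict_space1 measurable_completion) simp
    show "norm (g t * cis (- (real_of_int j * t))) \<le> 2 * \<bar>C\<bar>" if "t \<in> {-pi..pi}" for t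
      using bound[OF that] by (simp add: norm_mult)
  qed auto
  have intg2: "(\<lambda>t. (norm (g t))\<^sup>2) integrable_on {-pi..pi}"
  proof (rule measurable_bounded_by_integrable_imp_integrable)
    have "(\<lambda>t. (norm (g t))\<^sup>2) \<in> borel_measurable borel" using meas by measurable
    then show "(\<lambda>t. (norm (g t))\<^sup>2) \<in> borel_measurable (lebesgue_on {-pi..pi})"
      by (intro measurable_restrict_space1 measurable_completion) simp
    show "norm ((norm (g t))\<^sup>2) \<le> (2 * \<bar>C\<bar>)\<^sup>2" if "t \<in> {-pi..pi}" for t
      using power_mono[OF bound[OF that], of 2] by simp
  qed auto
  define \<gamma> where "\<gamma> = (\<lambda>j::int. cmean (\<lambda>t. g t * cis (- (real_of_int j * t))))"
  \<comment> \<open>A Riemann-Lebesgue statement: by Bessel the squared coefficients along distinct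
    indices are summable, hence tend to 0.\<close>
  have lim: "(\<lambda>n. \<gamma> (h n)) \<longlonglongrightarrow> 0" if "inj h" for h :: "nat \<Rightarrow> int"
  proof -
    have "summable (\<lambda>n. (norm (\<gamma> (h n)))\<^sup>2)"
    proof (rule summableI_nonneg_bounded)
      fix M
      have "(\<Sum>n<M. (norm (\<gamma> (h n)))\<^sup>2) = (\<Sum>j\<in>h ` {..<M}. (norm (\<gamma> j))\<^sup>2)"
        using that by (subst sum.reindex) (auto intro: inj_on_subset)
      also have "\<dots> \<le> mean_sq g" unfolding \<gamma>_def by (rule bessel_inequality[OF intg intg2]) simp
      finally show "(\<Sum>n<M. (norm (\<gamma> (h n)))\<^sup>2) \<le> mean_sq g" .
    qed simp
    then have "(\<lambda>n. (norm (\<gamma> (h n)))\<^sup>2) \<longlonglongrightarrow> 0" by (rule summable_LIMSEQ_zero)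
    then have "(\<lambda>n. sqrt ((norm (\<gamma> (h n)))\<^sup>2)) \<longlonglongrightarrow> sqrt 0" by (rule tendsto_real_sqrt)
    then show ?thesis by (simp add: tendsto_norm_zero_iff)
  qed
  \<comment> \<open>Write \<open>f (x + t) = f x + g t * (cis t - 1)\<close>; the factor
    \<open>cis t\<close> lowers the index of the coefficient of \<open>g\<close> by one, whence a
    telescoping difference.\<close>
  have coeff: "fourier_coeff f j * cis (real_of_int j * x) = of_bool (j = 0) * of_real (f x) + (\<gamma> (j - 1) - \<gamma> j)" for j
  proof -
    have int1: "(\<lambda>t. of_real (f x) * cis (of_int (- j) * t)) integrable_on {-pi..pi}"
      by (intro integrable_continuous_interval continuous_intros)
    have int2: "(\<lambda>t. g t * cis (- (real_of_int (j - 1) * t)) - g t * cis (- (real_of_int j * t))) integrable_on {-pi..pi}"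
      by (intro integrable_diff intg)
    have "fourier_coeff f j * cis (real_of_int j * x) =
        cmean (\<lambda>t. complex_of_real (f (t + x)) * cis (- (real_of_int j * t)))"
      using fourier_coeff_shift[OF cont per x, of j] by (simp add: fourier_coeff_eq_cmean)
    also have "\<dots> = cmean (\<lambda>t. of_real (f x) * cis (of_int (- j) * t) +
        (g t * cis (- (real_of_int (j - 1) * t)) - g t * cis (- (real_of_int j * t))))"
      unfolding cmean_def
    proof (intro arg_cong2[where f = "(*)"] refl integral_cong)
      fix t assume t: "t \<in> {-pi..pi}"
      have "complex_of_real (f (x + t) - f x) = g t * (cis t - 1)"
      proof (cases "cis t = 1")
        case True
        then have "t = 0" using norm_cis_minus_one_ge[of t] t by auto
        then show ?thesis by simp
      qed (simp add: g_def)
      then have "complex_of_real (f (t + x)) = of_real (f x) + g t * (cis t - 1)"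
        by (simp add: add.commute algebra_simps)
      moreover have "cis (- (real_of_int (j - 1) * t)) = cis t * cis (- (real_of_int j * t))"
        by (simp add: cis_mult algebra_simps)
      ultimately show "complex_of_real (f (t + x)) * cis (- (real_of_int j * t)) =
         of_real (f x) * cis (of_int (- j) * t) +
        (g t * cis (- (real_of_int (j - 1) * t)) - g t * cis (- (real_of_int j * t)))"
        by (simp only: of_int_minus mult_minus_left) (simp add: ring_distribs)
    qed
    also have "\<dots> = cmean (\<lambda>t. of_real (f x) * cis (of_int (- j) * t)) + (\<gamma> (j - 1) - \<gamma> j)"
      by (subst cmean_add[OF int1 int2], subst cmean_diff[OF intg intg]) (simp add: \<gamma>_def)
    also have "cmean (\<lambda>t. of_real (f x) * cis (of_int (- j) * t)) = of_bool (j = 0) * of_real (f x)"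
      unfolding cmean_cmult cmean_cis by simp
    finally show ?thesis .
  qed
  have tele: "(\<Sum>j\<in>{-int M..int M}. \<gamma> (j - 1) - \<gamma> j) = \<gamma> (- int M - 1) - \<gamma> (int M)" for M
  proof (induction M)
    case (Suc M)
    have "{-int (Suc M)..int (Suc M)} = insert (- int (Suc M)) (insert (int (Suc M)) {-int M..int M})"
      by auto
    then have step: "(\<Sum>j\<in>{-int (Suc M)..int (Suc M)}. \<gamma> (j - 1) - \<gamma> j) =
       (\<gamma> (- int (Suc M) - 1) - \<gamma> (- int (Suc M))) + ((\<gamma> (int (Suc M) - 1) - \<gamma> (int (Suc M))) +
       (\<gamma> (- int M - 1) - \<gamma> (int M)))"
      unfolding Suc.IH[symmetric] by (simp del: of_nat_Suc)
    have "\<gamma> (- int (Suc M)) = \<gamma> (- int M - 1)" "\<gamma> (int (Suc M) - 1) = \<gamma> (int M)"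
      by (rule arg_cong[of _ _ \<gamma>], simp)+
    then show ?case unfolding step by (simp only: add_diff_eq diff_add_cancel algebra_simps)
  qed simp
  have "(\<Sum>j\<in>{-int M..int M}. fourier_coeff f j * cis (real_of_int j * x)) =
      of_real (f x) + (\<gamma> (- int M - 1) - \<gamma> (int M))" for M
  proof -
    have "(\<Sum>j\<in>{-int M..int M}. of_bool (j = 0) * complex_of_real (f x)) =
        (\<Sum>j\<in>{0::int}. of_bool (j = 0) * complex_of_real (f x))"
      by (rule sum.mono_neutral_right) auto
    then show ?thesis unfolding coeff sum.distrib tele by simp
  qed
  moreover have "(\<lambda>M. of_real (f x) + (\<gamma> (- int M - 1) - \<gamma> (int M))) \<longlonglongrightarrow> of_real (f x) + (0 - 0)"
    by (intro tendsto_intros lim) (auto simp: inj_def)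
  ultimately show ?thesis by simp
qed

section \<open>Factorisation of the weight on the circle\<close>

text \<open>The coefficients of \<open>N\<close> as a power series in \<open>1/z\<close>.\<close>

definition V_coeff :: "(real \<Rightarrow> real) \<Rightarrow> nat \<Rightarrow> complex" where
  "V_coeff V j = (if j = 0 then 0 else fourier_coeff V (- int j))"

lemma summable_V_coeff_weighted:
  assumes "C_lip_circle k V" "k \<ge> 1"
  shows "summable (\<lambda>j. (real j ^ k * norm (V_coeff V j))\<^sup>2)"
  by (rule summable_square_mono[OF C_lip_circle_coeff_summable[OF assms]]) (auto simp: V_coeff_def)

lemma summable_norm_V_coeff:
  assumes "C_lip_circle k V" "k \<ge> 1"
  shows "summable (\<lambda>j. norm (V_coeff V j))"
proof (rule summable_if_square_summable_weight)
  show "summable (\<lambda>j. (real j * norm (V_coeff V j))\<^sup>2)"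
  proof (rule summable_square_mono[OF summable_V_coeff_weighted[OF assms]])
    fix j
    have "real j ^ 1 * norm (V_coeff V j) \<le> real j ^ k * norm (V_coeff V j)"
      using assms by (intro mult_right_mono power_le_power_nat_real) auto
    then show "real j * norm (V_coeff V j) \<le> real j ^ k * norm (V_coeff V j)" by simp
  qed simp
qed simp

text \<open>The series of \<open>N\<close> starts at the first power of \<open>1 / z\<close>, which
  agrees with the index 0 start of \<open>psum\<close> because
  \<open>V_coeff V 0 = 0\<close>.\<close>

lemma N_fun_eq_psum:
  assumes "C_lip_circle k V" "k \<ge> 1" "norm z \<ge> 1"
  shows "N_fun V z = psum (V_coeff V) (1 / z)"
proof -
  have "norm (1 / z) \<le> 1" using assms(3) by (auto simp: norm_divide divide_le_eq_1)
  from psum_sums[OF summable_norm_V_coeff[OF assms(1,2)] this]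
  have "(\<lambda>n. V_coeff V (Suc n) * (1 / z) ^ Suc n) sums psum (V_coeff V) (1 / z)"
    by (subst sums_Suc_iff) (simp add: V_coeff_def[of V 0])
  then show ?thesis by (simp add: N_fun_def V_coeff_def sums_iff power_divide)
qed

text \<open>For real \<open>V\<close> the Fourier terms at \<open>j\<close> and \<open>-j\<close>
  are conjugate, so each pair contributes twice a real part to the symmetric partial sums.\<close>

lemma V_eq_Re_psum:
  assumes V: "C_lip_circle k V" "k \<ge> 1" and x: "x \<in> {-pi..pi}"
  shows "V x = Re (fourier_coeff V 0) + 2 * Re (psum (V_coeff V) (cis (- x)))"
proof -
  obtain C where C: "\<And>t. \<bar>t\<bar> \<le> pi \<Longrightarrow> \<bar>V (x + t) - V x\<bar> \<le> C * \<bar>t\<bar>"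
    using C_lip_circle_lipschitz_at[OF V] by metis
  have "continuous_on UNIV V" using C_lip_circle_continuous_deriv[OF V(1), of 0] by simp
  moreover have "\<And>y. V (y + 2 * pi) = V y" using V by (simp add: C_lip_circle_def)
  ultimately have lim: "(\<lambda>M. \<Sum>j\<in>{-int M..int M}. fourier_coeff V j * cis (real_of_int j * x)) \<longlonglongrightarrow> of_real (V x)"
    by (rule fourier_series_converges[OF _ _ _ C]) (use x in auto)
  have "Re (\<Sum>j\<in>{-int M..int M}. fourier_coeff V j * cis (real_of_int j * x)) =
     Re (fourier_coeff V 0) + 2 * Re (\<Sum>n<Suc M. V_coeff V n * cis (- x) ^ n)" for M
  proof (induction M)
    case (Suc M)
    have "{-int (Suc M)..int (Suc M)} = insert (- int (Suc M)) (insert (int (Suc M)) {-int M..int M})"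
      by auto
    then have "Re (\<Sum>j\<in>{-int (Suc M)..int (Suc M)}. fourier_coeff V j * cis (real_of_int j * x)) =
      Re (fourier_coeff V (- int (Suc M)) * cis (- (real (Suc M) * x))) +
      Re (fourier_coeff V (int (Suc M)) * cis (real (Suc M) * x)) +
      Re (\<Sum>j\<in>{-int M..int M}. fourier_coeff V j * cis (real_of_int j * x))"
      by (simp del: of_nat_Suc)
    also have "fourier_coeff V (int (Suc M)) * cis (real (Suc M) * x) =
        cnj (fourier_coeff V (- int (Suc M)) * cis (- (real (Suc M) * x)))"
      by (simp add: fourier_coeff_uminus cis_cnj del: of_nat_Suc)
    also have "Re (fourier_coeff V (- int (Suc M)) * cis (- (real (Suc M) * x))) + Re (cnj (fourier_coeff V (- int (Suc M)) * cis (- (real (Suc M) * x))))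
       = 2 * Re (V_coeff V (Suc M) * cis (- x) ^ Suc M)"
      unfolding Complex.DeMoivre by (simp add: V_coeff_def)
    finally show ?case unfolding Suc.IH sum.lessThan_Suc[of _ "Suc M"] by simp
  qed (simp add: V_coeff_def)
  with tendsto_Re[OF lim]
  have "(\<lambda>M. Re (fourier_coeff V 0) + 2 * Re (\<Sum>n<Suc M. V_coeff V n * cis (- x) ^ n)) \<longlonglongrightarrow> V x"
    by simp
  moreover have "(\<lambda>M. \<Sum>n<Suc M. V_coeff V n * cis (- x) ^ n) \<longlonglongrightarrow> psum (V_coeff V) (cis (- x))"
    using psum_sums[OF summable_norm_V_coeff[OF V], of "cis (-x)"] unfolding sums_def
    by (rule LIMSEQ_Suc) simp
  then have "(\<lambda>M. Re (fourier_coeff V 0) + 2 * Re (\<Sum>n<Suc M. V_coeff V n * cis (- x) ^ n)) \<longlonglongrightarrow>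
     Re (fourier_coeff V 0) + 2 * Re (psum (V_coeff V) (cis (- x)))"
    by (intro tendsto_intros)
  ultimately show ?thesis by (rule LIMSEQ_unique)
qed

text \<open>The Szego factorisation: \<open>exp (- 2 * Re G)\<close> is the squared modulus of
  \<open>exp (- G)\<close>.\<close>

lemma exp_minus_V_eq:
  assumes V: "C_lip_circle k V" "k \<ge> 1" and x: "x \<in> {-pi..pi}"
  shows "exp (- V x) = exp (- Re (fourier_coeff V 0)) * (norm (exp (- psum (V_coeff V) (cis (- x)))))\<^sup>2"
  unfolding V_eq_Re_psum[OF assms] norm_exp_eq_Re
  by (simp add: exp_add[symmetric] power2_eq_square)

subsection \<open>The reflected orthogonal polynomial as a best approximation\<close>

text \<open>Each termwise differentiation raises the degree of the weight by one and keeps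
  convergence in the unit disc.\<close>

lemma summable_poly_times_geometric:
  fixes t :: real
  assumes "0 \<le> t" "t < 1"
  shows "summable (\<lambda>j. real (Suc j) ^ d * t ^ j)"
  using assms
proof (induction d arbitrary: t)
  case 0
  then show ?case by (simp add: summable_geometric)
next
  case (Suc d)
  have "summable (\<lambda>n. diffs (\<lambda>j. real (Suc j) ^ d) n * t ^ n)"
  proof (rule termdiff_converges[of t 1])
    fix x :: real assume "norm x < 1"
    then have "summable (\<lambda>j. real (Suc j) ^ d * \<bar>x\<bar> ^ j)" by (intro Suc.IH) auto
    then have "summable (\<lambda>j. norm (real (Suc j) ^ d * x ^ j))" by (simp add: abs_mult power_abs)
    then show "summable (\<lambda>j. real (Suc j) ^ d * x ^ j)" by (rule summable_norm_cancel)
  qed (use Suc.prems in auto)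
  then show ?case
  proof (rule summable_comparison_test')
    fix n
    have "real (Suc n) ^ Suc d \<le> real (Suc n) * real (Suc (Suc n)) ^ d"
      by (auto intro!: mult_left_mono power_mono)
    then show "norm (real (Suc n) ^ Suc d * t ^ n) \<le> diffs (\<lambda>j. real (Suc j) ^ d) n * t ^ n"
      using Suc.prems by (simp add: diffs_def mult_right_mono del: of_nat_Suc power_Suc)
  qed
qed

section \<open>Taylor truncations and their mean-square error\<close>

definition trunc_poly :: "(nat \<Rightarrow> complex) \<Rightarrow> nat \<Rightarrow> complex poly" where
  "trunc_poly x m = (\<Sum>i\<le>m. monom (x i) i)"

lemma coeff_trunc_poly: "coeff (trunc_poly x m) i = (if i \<le> m then x i else 0)"
  by (simp add: trunc_poly_def coeff_sum)

lemma degree_trunc_poly: "degree (trunc_poly x m) \<le> m"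
  by (rule degree_le) (simp add: coeff_trunc_poly)

lemma psum_diff:
  assumes "summable (\<lambda>n. norm (a n))" "summable (\<lambda>n. norm (b n))" "norm s \<le> 1"
  shows "psum (\<lambda>n. a n - b n) s = psum a s - psum b s"
  using sums_diff[OF psum_sums[OF assms(1,3)] psum_sums[OF assms(2,3)]]
  by (simp add: psum_def sums_iff left_diff_distrib)

lemma summable_norm_diff:
  fixes a b :: "nat \<Rightarrow> complex"
  assumes "summable (\<lambda>n. norm (a n))" "summable (\<lambda>n. norm (b n))"
  shows "summable (\<lambda>n. norm (a n - b n))"
  by (rule summable_comparison_test'[OF summable_add[OF assms]]) (auto intro: norm_triangle_ineq4)

text \<open>By Parseval the error is the sum of squares over the indices \<open>i > m\<close>, where
  \<open>(i / m) ^ k \<ge> 1\<close> may be inserted.\<close>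

lemma mean_sq_trunc_le:
  assumes x: "summable (\<lambda>n. norm (x n))" and w: "summable (\<lambda>i. (real i ^ k * norm (x i))\<^sup>2)" and m: "m \<ge> 1"
  shows "mean_sq (\<lambda>\<theta>. psum x (cis (- \<theta>)) - poly (trunc_poly x m) (cis (- \<theta>)))
    \<le> (\<Sum>i. (real i ^ k * norm (x i))\<^sup>2) / real m ^ (2 * k)"
proof -
  let ?a = "\<lambda>i. x i - coeff (trunc_poly x m) i"
  note a = summable_norm_diff[OF x summable_norm_coeff]
  have "(\<lambda>\<theta>. psum x (cis (- \<theta>)) - poly (trunc_poly x m) (cis (- \<theta>))) = (\<lambda>\<theta>. psum ?a (cis (- \<theta>)))"
    by (simp add: psum_diff[OF x summable_norm_coeff] psum_coeff)
  then have P: "(\<lambda>n. (norm (?a n))\<^sup>2) sums mean_sq (\<lambda>\<theta>. psum x (cis (- \<theta>)) - poly (trunc_poly x m) (cis (- \<theta>)))"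
    using parseval_psum[OF a] by simp
  show ?thesis
  proof (rule sums_le[OF _ P])
    show "(\<lambda>i. (real i ^ k * norm (x i))\<^sup>2 / real m ^ (2 * k)) sums ((\<Sum>i. (real i ^ k * norm (x i))\<^sup>2) / real m ^ (2 * k))"
      by (intro sums_divide summable_sums w)
    show "(norm (?a i))\<^sup>2 \<le> (real i ^ k * norm (x i))\<^sup>2 / real m ^ (2 * k)" for i
    proof (cases "i \<le> m")
      case False
      then have "real m ^ k * norm (x i) \<le> real i ^ k * norm (x i)"
        by (intro mult_right_mono power_mono) auto
      then have "(real m ^ k * norm (x i))\<^sup>2 \<le> (real i ^ k * norm (x i))\<^sup>2"
        by (intro power_mono) auto
      then show ?thesis using False m
        by (simp add: coeff_trunc_poly field_simps power_mult_distrib flip: power_mult)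
    qed (simp add: coeff_trunc_poly)
  qed
qed

lemma cmean_cnj: "cmean (\<lambda>\<theta>. cnj (h \<theta>)) = cnj (cmean h)"
  by (simp add: cmean_def integral_cnj)

lemma cnj_poly_cis:
  "cnj (poly p (cis (- \<theta>))) = (\<Sum>i\<le>degree p. cnj (coeff p i) * cis (real i * \<theta>))"
  by (simp add: poly_altdef Complex.DeMoivre cis_cnj)

section \<open>Orthogonality relations and doubling of the exponent\<close>

text \<open>Here \<open>x\<close> and \<open>y\<close> are the coefficients of \<open>e\<^sup>G\<close> and \<open>e\<^sup>-\<^sup>G\<close>, and \<open>Q\<close> is the reflected orthogonal polynomial.\<close>

locale szego_approx =
  fixes x y :: "nat \<Rightarrow> complex" and n :: nat and Q :: "complex poly" and B C :: real and k :: nat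
  assumes x: "summable (\<lambda>i. norm (x i))" "x 0 = 1"
    and y: "summable (\<lambda>i. norm (y i))" "y 0 = 1"
    and inverse_y: "\<And>s. norm s \<le> 1 \<Longrightarrow> psum x s * psum y s = 1"
    and bound_y: "\<And>s. norm s \<le> 1 \<Longrightarrow> norm (psum y s) \<le> C"
    and tail: "\<And>m. m \<ge> 1 \<Longrightarrow> mean_sq (\<lambda>\<theta>. psum x (cis (- \<theta>)) - poly (trunc_poly x m) (cis (- \<theta>))) \<le> B / real m ^ (2 * k)"
    and B: "0 \<le> B"
    and n: "n \<ge> 1" and Q: "degree Q \<le> n" "coeff Q 0 = 1"
    and orth: "\<And>l. l \<in> {1..n} \<Longrightarrow>
      cmean (\<lambda>\<theta>. poly Q (cis (- \<theta>)) * cis (real l * \<theta>) * of_real ((norm (psum y (cis (- \<theta>))))\<^sup>2)) = 0"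
begin

definition R :: "real \<Rightarrow> complex" where "R \<theta> = poly Q (cis (- \<theta>)) * psum y (cis (- \<theta>)) - 1"

text \<open>These are the power series coefficients of \<open>R\<close>; \<open>coeff 1\<close> is
  the coefficient sequence of the constant polynomial, so 1 is subtracted at index 0 only.\<close>

definition r :: "nat \<Rightarrow> complex" where
  "r m = (\<Sum>i\<le>m. coeff Q i * y (m - i)) - coeff 1 m"

lemma summable_r: "summable (\<lambda>m. norm (r m))"
  unfolding r_def
  by (intro summable_norm_diff summable_norm_convolution summable_norm_coeff y)

lemma psum_r:
  assumes "norm s \<le> 1"
  shows "psum r s = poly Q s * psum y s - 1"
proof -
  have "psum r s = psum (\<lambda>m. \<Sum>i\<le>m. coeff Q i * y (m - i)) s - psum (coeff 1) s"
    unfolding r_def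
    by (rule psum_diff[OF summable_norm_convolution[OF summable_norm_coeff y(1)] summable_norm_coeff assms])
  then show ?thesis
    by (simp only: psum_mult[OF summable_norm_coeff y(1) assms, symmetric] psum_coeff poly_1)
qed

lemma r_0: "r 0 = 0"
  by (simp add: r_def Q y)

lemma cont_y: "continuous_on S (\<lambda>\<theta>. psum y (cis (- \<theta>)))"
  by (rule continuous_on_psum_cis[OF y(1)])

lemma cont_R: "continuous_on S R"
  unfolding R_def[abs_def] by (intro continuous_intros cont_y)

lemma R_eq: "R \<theta> = psum r (cis (- \<theta>))"
  by (simp add: psum_r R_def)

text \<open>The two parts of \<open>R\<close> vanish separately. The part with \<open>Q\<close> does
  so by \<open>orth\<close>, since \<open>p\<close> involves only the powers 1 to \<open>n\<close>;
  the constant part gives the conjugate of the value at 0 of \<open>p\<close> times the series of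
  \<open>y\<close>.\<close>

lemma orthogonal:
  assumes p: "degree p \<le> n" "coeff p 0 = 0"
  shows "cmean (\<lambda>\<theta>. R \<theta> * cnj (poly p (cis (- \<theta>)) * psum y (cis (- \<theta>)))) = 0"
proof -
  let ?q = "\<lambda>\<theta>. poly Q (cis (- \<theta>))" and ?y = "\<lambda>\<theta>. psum y (cis (- \<theta>))"
  have "cmean (\<lambda>\<theta>. R \<theta> * cnj (poly p (cis (- \<theta>)) * ?y \<theta>)) =
     cmean (\<lambda>\<theta>. (\<Sum>i\<le>degree p. cnj (coeff p i) * (?q \<theta> * cis (real i * \<theta>) * of_real ((norm (?y \<theta>))\<^sup>2)))
       - cnj (poly p (cis (- \<theta>)) * ?y \<theta>))"
  proof (rule cmean_cong)
    fix \<theta>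
    have "(\<Sum>i\<le>degree p. cnj (coeff p i) * (?q \<theta> * cis (real i * \<theta>) * of_real ((norm (?y \<theta>))\<^sup>2))) =
       cnj (poly p (cis (- \<theta>))) * (?q \<theta> * (?y \<theta> * cnj (?y \<theta>)))"
      unfolding cnj_poly_cis sum_distrib_right complex_norm_square by (simp add: mult_ac)
    then show "R \<theta> * cnj (poly p (cis (- \<theta>)) * ?y \<theta>) =
      (\<Sum>i\<le>degree p. cnj (coeff p i) * (?q \<theta> * cis (real i * \<theta>) * of_real ((norm (?y \<theta>))\<^sup>2)))
       - cnj (poly p (cis (- \<theta>)) * ?y \<theta>)"
      by (simp add: R_def algebra_simps)
  qed
  also have "\<dots> = (\<Sum>i\<le>degree p. cnj (coeff p i) * cmean (\<lambda>\<theta>. ?q \<theta> * cis (real i * \<theta>) * of_real ((norm (?y \<theta>))\<^sup>2)))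
     - cnj (cmean (\<lambda>\<theta>. poly p (cis (- \<theta>)) * ?y \<theta>))"
    by (subst cmean_diff, (intro integrable_continuous_interval continuous_intros cont_y)+,
        subst cmean_sum, simp, (intro integrable_continuous_interval continuous_intros cont_y)+)
       (simp add: cmean_cmult cmean_cnj del: complex_cnj_mult)
  also have "(\<Sum>i\<le>degree p. cnj (coeff p i) * cmean (\<lambda>\<theta>. ?q \<theta> * cis (real i * \<theta>) * of_real ((norm (?y \<theta>))\<^sup>2))) = 0"
  proof (rule sum.neutral, rule ballI)
    fix i assume "i \<in> {..degree p}"
    then show "cnj (coeff p i) * cmean (\<lambda>\<theta>. ?q \<theta> * cis (real i * \<theta>) * of_real ((norm (?y \<theta>))\<^sup>2)) = 0"
      using p orth[of i] by (cases "i = 0") auto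
  qed
  also have "cmean (\<lambda>\<theta>. poly p (cis (- \<theta>)) * ?y \<theta>) = 0"
  proof -
    have "cmean (\<lambda>\<theta>. psum (\<lambda>m. \<Sum>i\<le>m. coeff p i * y (m - i)) (cis (- \<theta>)) * cis (real 0 * \<theta>)) = 0"
      by (subst cmean_psum) (auto intro!: summable_norm_convolution summable_norm_coeff y simp: p)
    then show ?thesis
      by (simp add: psum_coeff flip: psum_mult[OF summable_norm_coeff y(1)])
  qed
  finally show ?thesis by simp
qed

text \<open>Since the series of \<open>x\<close> and \<open>y\<close> are reciprocal,
  \<open>1 - T * y = y * (x - T)\<close>. The unimodular factor with exponent \<open>j\<close> is
  carried along for the duality step.\<close>

lemma mean_sq_approx:
  assumes "m \<ge> 1"
  shows "mean_sq (\<lambda>\<theta>. cis (- \<theta>) ^ j * (1 - poly (trunc_poly x m) (cis (- \<theta>)) * psum y (cis (- \<theta>)))) \<le> C\<^sup>2 * B / real m ^ (2 * k)"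
proof -
  let ?T = "\<lambda>\<theta>. poly (trunc_poly x m) (cis (- \<theta>))"
  have "mean_sq (\<lambda>\<theta>. cis (- \<theta>) ^ j * (1 - ?T \<theta> * psum y (cis (- \<theta>)))) \<le>
      C\<^sup>2 * mean_sq (\<lambda>\<theta>. psum x (cis (- \<theta>)) - ?T \<theta>)"
  proof (rule mean_sq_mono)
    fix \<theta>
    have "1 - ?T \<theta> * psum y (cis (- \<theta>)) = psum y (cis (- \<theta>)) * (psum x (cis (- \<theta>)) - ?T \<theta>)"
      using inverse_y[of "cis (- \<theta>)"] by (simp add: algebra_simps)
    then show "norm (cis (- \<theta>) ^ j * (1 - ?T \<theta> * psum y (cis (- \<theta>)))) \<le> C * norm (psum x (cis (- \<theta>)) - ?T \<theta>)"
      using bound_y[of "cis (- \<theta>)"] by (simp add: norm_mult norm_power mult_right_mono)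
  qed (intro continuous_intros cont_y continuous_on_psum_cis x)+
  also have "\<dots> \<le> C\<^sup>2 * (B / real m ^ (2 * k))" by (intro mult_left_mono tail assms) simp
  finally show ?thesis by simp
qed

text \<open>Decompose \<open>R\<close> as \<open>Q - a\<close> times the series of \<open>y\<close>,
  minus \<open>h\<close>. The first piece is orthogonal to \<open>R\<close> because \<open>Q\<close>
  and \<open>a\<close> share the constant term 1, so \<open>|R|^2\<close> has the same mean as
  \<open>-R * cnj h\<close>, and half of it is absorbed on the left.\<close>

lemma mean_sq_R: "mean_sq R \<le> C\<^sup>2 * B / real n ^ (2 * k)"
proof -
  let ?y = "\<lambda>\<theta>. psum y (cis (- \<theta>))"
  define a where "a = trunc_poly x n"
  define h where "h = (\<lambda>\<theta>. 1 - poly a (cis (- \<theta>)) * ?y \<theta>)"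
  have conth: "continuous_on S h" for S unfolding h_def by (intro continuous_intros cont_y)
  have Ra: "R \<theta> = poly (Q - a) (cis (- \<theta>)) * ?y \<theta> - h \<theta>" for \<theta>
    by (simp add: R_def h_def algebra_simps)
  have "complex_of_real (mean_sq R) = cmean (\<lambda>\<theta>. R \<theta> * cnj (R \<theta>))"
    by (rule cmean_mult_cnj[symmetric]) (intro integrable_continuous_interval continuous_intros cont_R)
  also have "\<dots> = cmean (\<lambda>\<theta>. R \<theta> * cnj (poly (Q - a) (cis (- \<theta>)) * ?y \<theta>) - R \<theta> * cnj (h \<theta>))"
    by (rule cmean_cong) (subst (2) Ra, simp add: algebra_simps)
  also have "\<dots> = cmean (\<lambda>\<theta>. R \<theta> * cnj (poly (Q - a) (cis (- \<theta>)) * ?y \<theta>)) - cmean (\<lambda>\<theta>. R \<theta> * cnj (h \<theta>))"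
    by (rule cmean_diff) (intro integrable_continuous_interval continuous_intros cont_R cont_y conth)+
  also have "cmean (\<lambda>\<theta>. R \<theta> * cnj (poly (Q - a) (cis (- \<theta>)) * ?y \<theta>)) = 0"
    using Q by (intro orthogonal) (auto simp: a_def coeff_trunc_poly x degree_trunc_poly intro!: degree_diff_le)
  finally have "mean_sq R = norm (cmean (\<lambda>\<theta>. R \<theta> * cnj (h \<theta>)))"
    by (metis diff_0 mean_sq_nonneg norm_minus_cancel norm_of_real abs_of_nonneg)
  also have "\<dots> \<le> (mean_sq R + mean_sq h) / 2"
    by (rule norm_cmean_mult_cnj_le[OF cont_R conth])
  finally have "mean_sq R \<le> mean_sq h" by simp
  also have "mean_sq h \<le> C\<^sup>2 * B / real n ^ (2 * k)"
    using mean_sq_approx[OF n, of 0] by (simp add: h_def a_def)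
  finally show ?thesis .
qed

text \<open>The polynomial weight in \<open>j\<close> makes one bound serve all indices: it pays for
  the shorter truncation degree \<open>n - j\<close> when \<open>j < n\<close>, and for having only
  a crude estimate when \<open>j \<ge> n\<close>.\<close>

lemma norm_r_le: "norm (r j) \<le> (C\<^sup>2 * B + 1) * real (Suc j) ^ (2 * k) / real n ^ (2 * k)"
proof -
  have rj: "r j = cmean (\<lambda>\<theta>. R \<theta> * cnj (cis (- \<theta>) ^ j))"
    using cmean_psum[OF summable_r, of j] by (simp add: R_eq Complex.DeMoivre cis_cnj)
  have CB: "C\<^sup>2 * B \<ge> 0" using B by simp
  have np: "real n ^ (2 * k) \<ge> 1" using n by simp
  consider "j = 0" | "1 \<le> j" "j < n" | "n \<le> j" by linarith
  then show ?thesis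
  proof cases
    case 1
    then show ?thesis using CB by (simp add: r_0)
  next
    case 2
    let ?y = "\<lambda>\<theta>. psum y (cis (- \<theta>))"
    \<comment> \<open>Adding a multiple of \<open>y\<close> by a polynomial of degree at most
      \<open>n\<close> vanishing at 0 changes no mean against \<open>R\<close>; here
      \<open>j \<ge> 1\<close> gives the zero, and truncation at \<open>n - j\<close> keeps the
      degree.\<close>
    define p where "p = monom 1 j * trunc_poly x (n - j)"
    define h where "h = (\<lambda>\<theta>. cis (- \<theta>) ^ j * (1 - poly (trunc_poly x (n - j)) (cis (- \<theta>)) * ?y \<theta>))"
    have conth: "continuous_on S h" for S unfolding h_def by (intro continuous_intros cont_y)
    have p: "degree p \<le> n" "coeff p 0 = 0"
    proof -
      have "degree p \<le> j + (n - j)" unfolding p_def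
        by (rule order_trans[OF degree_mult_le]) (intro add_mono degree_monom_le degree_trunc_poly)
      then show "degree p \<le> n" using 2 by simp
      show "coeff p 0 = 0" using 2 by (simp add: p_def coeff_mult)
    qed
    have "r j = cmean (\<lambda>\<theta>. R \<theta> * cnj (poly p (cis (- \<theta>)) * ?y \<theta>) + R \<theta> * cnj (h \<theta>))"
      unfolding rj by (rule cmean_cong) (simp add: p_def h_def poly_monom algebra_simps)
    also have "\<dots> = cmean (\<lambda>\<theta>. R \<theta> * cnj (poly p (cis (- \<theta>)) * ?y \<theta>)) + cmean (\<lambda>\<theta>. R \<theta> * cnj (h \<theta>))"
      by (rule cmean_add) (intro integrable_continuous_interval continuous_intros cont_R cont_y conth)+
    also have "\<dots> = cmean (\<lambda>\<theta>. R \<theta> * cnj (h \<theta>))" by (simp only: orthogonal[OF p] add_0_left)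
    finally have "norm (r j) \<le> (mean_sq R + mean_sq h) / 2"
      using norm_cmean_mult_cnj_le[OF cont_R conth] by simp
    also have "\<dots> \<le> (C\<^sup>2 * B / real n ^ (2 * k) + C\<^sup>2 * B / real (n - j) ^ (2 * k)) / 2"
    proof -
      have "mean_sq h \<le> C\<^sup>2 * B / real (n - j) ^ (2 * k)"
        unfolding h_def using 2 by (intro mean_sq_approx) simp
      then show ?thesis by (intro divide_right_mono add_mono mean_sq_R) auto
    qed
    also have "\<dots> \<le> C\<^sup>2 * B / real (n - j) ^ (2 * k)"
    proof -
      have "C\<^sup>2 * B / real n ^ (2 * k) \<le> C\<^sup>2 * B / real (n - j) ^ (2 * k)"
        using 2 CB by (intro divide_left_mono power_mono) auto
      moreover have "a \<le> b \<Longrightarrow> (a + b) / 2 \<le> b" for a b :: real by simp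
      ultimately show ?thesis by blast
    qed
    also have "\<dots> \<le> C\<^sup>2 * B * real (Suc j) ^ (2 * k) / real n ^ (2 * k)"
    proof -
      \<comment> \<open>With \<open>n = j + d + 1\<close> the right side is
        \<open>(j + 1) * (d + 1)\<close>; this trades \<open>1 / (n - j)\<close> for
        \<open>(j + 1) / n\<close>.\<close>
      have "n \<le> Suc j * (n - j)"
      proof -
        obtain d where "n = j + Suc d" using 2 by (metis less_imp_Suc_add add_Suc_right)
        then show ?thesis by simp
      qed
      then have "real n \<le> real (Suc j) * real (n - j)" by (metis of_nat_le_iff of_nat_mult)
      then have "real n ^ (2 * k) \<le> (real (Suc j) * real (n - j)) ^ (2 * k)" by (intro power_mono) auto
      then have "real n ^ (2 * k) \<le> real (Suc j) ^ (2 * k) * real (n - j) ^ (2 * k)"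
        by (simp only: power_mult_distrib)
      then have "1 / real (n - j) ^ (2 * k) \<le> real (Suc j) ^ (2 * k) / real n ^ (2 * k)"
        using 2 np by (simp add: field_simps del: of_nat_Suc)
      from mult_left_mono[OF this CB] show ?thesis by simp
    qed
    also have "\<dots> \<le> (C\<^sup>2 * B + 1) * real (Suc j) ^ (2 * k) / real n ^ (2 * k)"
      by (intro divide_right_mono mult_right_mono) auto
    finally show ?thesis .
  next
    case 3
    \<comment> \<open>A bound independent of \<open>n\<close> is enough here, because
      \<open>(j + 1) / n \<ge> 1\<close>.\<close>
    have "norm (r j) \<le> (mean_sq R + mean_sq (\<lambda>\<theta>. cis (- \<theta>) ^ j)) / 2"
      unfolding rj by (rule norm_cmean_mult_cnj_le[OF cont_R]) (intro continuous_intros)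
    also have "mean_sq (\<lambda>\<theta>. cis (- \<theta>) ^ j) = 1" by (simp add: mean_sq_def norm_power)
    also have "(mean_sq R + 1) / 2 \<le> C\<^sup>2 * B + 1"
    proof -
      have "C\<^sup>2 * B / real n ^ (2 * k) \<le> C\<^sup>2 * B / 1" using CB np n by (intro divide_left_mono) auto
      then show ?thesis using mean_sq_R CB by simp
    qed
    also have "\<dots> \<le> (C\<^sup>2 * B + 1) * (real (Suc j) ^ (2 * k) / real n ^ (2 * k))"
    proof -
      have "1 \<le> real (Suc j) ^ (2 * k) / real n ^ (2 * k)"
        using 3 n np power_mono[of "real n" "real (Suc j)" "2 * k"] by (simp add: le_divide_eq del: of_nat_Suc)
      from mult_left_mono[OF this, of "C\<^sup>2 * B + 1"] show ?thesis using CB by simp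
    qed
    finally show ?thesis by simp
  qed
qed

text \<open>The coefficient bounds grow only polynomially in \<open>j\<close>, so inside a disc of
  radius \<open>t < 1\<close> they sum to a constant independent of \<open>n\<close>.\<close>

lemma norm_error_le:
  assumes s: "norm s \<le> t" and t: "0 \<le> t" "t < 1"
  shows "norm (poly Q s * psum y s - 1) \<le> (C\<^sup>2 * B + 1) * (\<Sum>j. real (Suc j) ^ (2 * k) * t ^ j) / real n ^ (2 * k)"
proof -
  let ?D = "(C\<^sup>2 * B + 1) / real n ^ (2 * k)"
  have "poly Q s * psum y s - 1 = psum r s" using s t by (simp add: psum_r)
  also have "norm \<dots> \<le> (\<Sum>j. ?D * (real (Suc j) ^ (2 * k) * t ^ j))"
    unfolding psum_def
  proof (rule norm_suminf_le)
    show "summable (\<lambda>j. ?D * (real (Suc j) ^ (2 * k) * t ^ j))"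
      by (intro summable_mult summable_poly_times_geometric t)
    show "norm (r j * s ^ j) \<le> ?D * (real (Suc j) ^ (2 * k) * t ^ j)" for j
    proof -
      have "norm (r j * s ^ j) \<le> ((C\<^sup>2 * B + 1) * real (Suc j) ^ (2 * k) / real n ^ (2 * k)) * t ^ j"
        unfolding norm_mult norm_power using s B by (intro mult_mono norm_r_le power_mono) auto
      then show ?thesis by simp
    qed
  qed
  also have "\<dots> = ?D * (\<Sum>j. real (Suc j) ^ (2 * k) * t ^ j)"
    by (intro suminf_mult summable_poly_times_geometric t)
  finally show ?thesis by simp
qed

end

subsection \<open>The exterior estimate\<close>

text \<open>On the circle, reflection multiplies by \<open>cis (- (real n * \<theta>))\<close>, so
  testing with index \<open>l\<close> in \<open>{1..n}\<close> is testing \<open>P\<close> against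
  the power \<open>n - l\<close>, which runs through 0 to \<open>n - 1\<close>. The positive
  constant of the factorisation cancels.\<close>

lemma reflected_OPUC_orthogonal:
  assumes V: "C_lip_circle k V" "k \<ge> 1" and P: "is_monic_OPUC V n P" and l: "l \<in> {1..n}"
  shows "cmean (\<lambda>\<theta>. poly (reflect_poly P) (cis (- \<theta>)) * cis (real l * \<theta>) *
    of_real ((norm (exp (- psum (V_coeff V) (cis (- \<theta>)))))\<^sup>2)) = 0"
proof -
  define c where "c = exp (- Re (fourier_coeff V 0))"
  have "c > 0" by (simp add: c_def)
  have "0 = weighted_inner V P (monom 1 (n - l))"
    using P l by (auto simp: is_monic_OPUC_def)
  also have "\<dots> = cmean (\<lambda>\<theta>. of_real c * (poly (reflect_poly P) (cis (- \<theta>)) * cis (real l * \<theta>) *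
    of_real ((norm (exp (- psum (V_coeff V) (cis (- \<theta>)))))\<^sup>2)))"
    unfolding weighted_inner_def cmean_def
  proof (rule arg_cong2[where f = "(*)"], rule refl, rule integral_cong)
    fix \<theta> assume \<theta>: "\<theta> \<in> {-pi..pi}"
    have "degree P = n" using P by (simp add: is_monic_OPUC_def)
    then have "poly (reflect_poly P) (cis (- \<theta>)) = cis (- (real n * \<theta>)) * poly P (cis \<theta>)"
      by (subst poly_reflect_poly_nz) (simp_all add: Complex.DeMoivre)
    then have "poly (reflect_poly P) (cis (- \<theta>)) * cis (real l * \<theta>) =
        poly P (cis \<theta>) * (cis (- (real n * \<theta>)) * cis (real l * \<theta>))"
      by (simp add: mult_ac)
    also have "cis (- (real n * \<theta>)) * cis (real l * \<theta>) = cnj (poly (monom 1 (n - l)) (cis \<theta>))"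
      using l by (simp add: poly_monom Complex.DeMoivre cis_cnj cis_mult of_nat_diff algebra_simps)
    finally have e: "poly (reflect_poly P) (cis (- \<theta>)) * cis (real l * \<theta>) =
        poly P (cis \<theta>) * cnj (poly (monom 1 (n - l)) (cis \<theta>))" .
    show "poly P (cis \<theta>) * cnj (poly (monom 1 (n - l)) (cis \<theta>)) * complex_of_real (exp (- V \<theta>)) =
      of_real c * (poly (reflect_poly P) (cis (- \<theta>)) * cis (real l * \<theta>) *
        of_real ((norm (exp (- psum (V_coeff V) (cis (- \<theta>)))))\<^sup>2))"
      unfolding e exp_minus_V_eq[OF V \<theta>] c_def[symmetric] by simp
  qed
  finally show ?thesis using \<open>c > 0\<close> by (simp add: cmean_cmult)
qed

text \<open>Every constant is fixed before \<open>n\<close>, so \<open>K\<close> depends only on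
  \<open>V\<close>, \<open>k\<close> and \<open>\<rho>\<close>.\<close>

lemma OPUC_exterior_estimate:
  assumes V: "C_lip_circle k V" "k \<ge> 1" and P: "\<And>n. is_monic_OPUC V n (P n)" and \<rho>: "\<rho> > 1"
  obtains K where "K \<ge> 0" "\<And>n z. n \<ge> 1 \<Longrightarrow> norm z \<ge> \<rho> \<Longrightarrow>
    norm (poly (P n) z / z ^ n * exp (- N_fun V z) - 1) \<le> K / real n ^ (2 * k)"
proof -
  define g where "g = V_coeff V"
  have g: "summable (\<lambda>j. norm (g j))" "g 0 = 0"
    using summable_norm_V_coeff[OF V] by (auto simp: g_def V_coeff_def)
  obtain x where x: "x 0 = 1" "\<And>m. of_nat m * x m = (\<Sum>i\<le>m. of_nat i * g i * x (m - i))"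
    "summable (\<lambda>n. norm (x n))" "\<And>s. norm s \<le> 1 \<Longrightarrow> psum x s = exp (psum g s)"
    by (rule exp_psum_coeffs[OF g]) blast
  have g': "summable (\<lambda>j. norm (- g j))" "- g 0 = 0" using g by auto
  have psum_minus: "psum (\<lambda>j. - g j) s = - psum g s" if "norm s \<le> 1" for s
    using sums_minus[OF psum_sums[OF g(1) that]] by (simp add: psum_def sums_iff)
  obtain y where y: "y 0 = 1" "summable (\<lambda>n. norm (y n))"
    "\<And>s. norm s \<le> 1 \<Longrightarrow> psum y s = exp (psum (\<lambda>j. - g j) s)"
    by (rule exp_psum_coeffs[OF g']) blast
  have y': "psum y s = exp (- psum g s)" if "norm s \<le> 1" for s
    using y(3)[OF that] psum_minus[OF that] by simp
  \<comment> \<open>Taking norms in the recursion for the coefficients of the exponential gives the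
    inequality that transfers the decay from \<open>V\<close> to \<open>x\<close>.\<close>
  have wx: "summable (\<lambda>m. (real m ^ k * norm (x m))\<^sup>2)"
  proof (rule weighted_square_summable_log_recursion[of "\<lambda>j. norm (g j)"])
    show "real m * norm (x m) \<le> (\<Sum>i\<le>m. real i * norm (g i) * norm (x (m - i)))" for m
    proof -
      have "real m * norm (x m) = norm (of_nat m * x m)" by (simp add: norm_mult)
      also have "\<dots> \<le> (\<Sum>i\<le>m. real i * norm (g i) * norm (x (m - i)))"
        unfolding x(2) by (rule sum_norm_le) (simp add: norm_mult)
      finally show ?thesis .
    qed
    show "summable (\<lambda>j. (real j ^ k * norm (g j))\<^sup>2)"
      unfolding g_def by (rule summable_V_coeff_weighted[OF V])
  qed (use x(3) V in auto)
  define B where "B = (\<Sum>i. (real i ^ k * norm (x i))\<^sup>2)"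
  have "B \<ge> 0" unfolding B_def by (intro suminf_nonneg wx) auto
  have "bounded (psum y ` cball 0 1)"
    by (intro compact_imp_bounded compact_continuous_image continuous_on_psum y(2)) simp
  then obtain C where "\<forall>v\<in>psum y ` cball 0 1. norm v \<le> C"
    by (auto simp only: bounded_iff)
  then have C: "\<And>s. norm s \<le> 1 \<Longrightarrow> norm (psum y s) \<le> C" by simp
  \<comment> \<open>Under \<open>s = 1 / z\<close> the region \<open>norm z \<ge> \<rho>\<close>
    becomes the punctured disc of radius \<open>t < 1\<close>.\<close>
  define t where "t = 1 / \<rho>"
  have t: "0 \<le> t" "t < 1" using \<rho> by (auto simp: t_def)
  define K where "K = (C\<^sup>2 * B + 1) * (\<Sum>j. real (Suc j) ^ (2 * k) * t ^ j)"
  have "K \<ge> 0" unfolding K_def using \<open>B \<ge> 0\<close> t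
    by (intro mult_nonneg_nonneg suminf_nonneg summable_poly_times_geometric) auto
  moreover have "norm (poly (P n) z / z ^ n * exp (- N_fun V z) - 1) \<le> K / real n ^ (2 * k)"
    if n: "n \<ge> 1" and z: "norm z \<ge> \<rho>" for n z
  proof -
    define Q where "Q = reflect_poly (P n)"
    have Pn: "degree (P n) = n" "lead_coeff (P n) = 1" using P[of n] by (auto simp: is_monic_OPUC_def)
    interpret szego_approx x y n Q B C k
    proof
      show "psum x s * psum y s = 1" if "norm s \<le> 1" for s
        using x(4)[OF that] y'[OF that] by (simp flip: exp_add)
      show "mean_sq (\<lambda>\<theta>. psum x (cis (- \<theta>)) - poly (trunc_poly x m) (cis (- \<theta>))) \<le> B / real m ^ (2 * k)"
        if "m \<ge> 1" for m
        unfolding B_def by (rule mean_sq_trunc_le[OF x(3) wx that])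
      show "degree Q \<le> n" unfolding Q_def using degree_reflect_poly_le[of "P n"] Pn by simp
      show "coeff Q 0 = 1" unfolding Q_def using Pn by simp
      show "cmean (\<lambda>\<theta>. poly Q (cis (- \<theta>)) * cis (real l * \<theta>) * of_real ((norm (psum y (cis (- \<theta>))))\<^sup>2)) = 0"
        if "l \<in> {1..n}" for l
        using reflected_OPUC_orthogonal[OF V P that] by (simp add: y' Q_def g_def)
    qed (use x y C \<open>B \<ge> 0\<close> n in auto)
    have z0: "z \<noteq> 0" "norm z \<ge> 1" using z \<rho> by auto
    have s: "norm (1 / z) \<le> t" using z \<rho> by (simp add: t_def norm_divide frac_le)
    then have s1: "norm (1 / z) \<le> 1" using t by simp
    have "poly (P n) z / z ^ n = poly Q (1 / z)"
      using z0 Pn by (simp add: Q_def poly_reflect_poly_nz power_divide)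
    moreover have "exp (- N_fun V z) = psum y (1 / z)"
      using N_fun_eq_psum[OF V z0(2)] y'[OF s1] by (simp add: g_def)
    ultimately show ?thesis
      using norm_error_le[OF s t] by (simp add: K_def)
  qed
  ultimately show ?thesis by (rule that)
qed

section \<open>Holomorphy in the exterior and passage to derivatives\<close>

lemma holomorphic_on_N_fun:
  assumes V: "C_lip_circle k V" "k \<ge> 1"
  shows "N_fun V holomorphic_on {z. norm z > 1}"
proof -
  have "(psum (V_coeff V) \<circ> (\<lambda>z. 1 / z)) holomorphic_on {z. norm z > 1}"
  proof (rule holomorphic_on_compose_gen[OF _ holomorphic_on_psum])
    show "(\<lambda>z. 1 / z) holomorphic_on {z::complex. norm z > 1}"
      by (intro holomorphic_intros) auto
    show "(\<lambda>z. 1 / z) ` {z::complex. norm z > 1} \<subseteq> ball 0 1"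
      by (auto simp: norm_divide divide_less_eq_1)
  qed (rule summable_norm_V_coeff[OF V])
  then show ?thesis
    by (rule holomorphic_transform) (use N_fun_eq_psum[OF V] in auto)
qed

theorem theorem3p1:
  fixes V :: "real \<Rightarrow> real" and k :: nat and P :: "nat \<Rightarrow> complex poly"
  assumes "k \<ge> 1"
    and "C_lip_circle k V"
    and "\<And>n. is_monic_OPUC V n (P n)"
  shows "\<forall>(p::nat) (\<rho>::real). \<rho> > 1 \<longrightarrow>
    (\<exists>K > 0. \<forall>\<^sub>F n in sequentially. \<forall>z::complex. norm z \<ge> \<rho> \<longrightarrow>
       norm ((deriv ^^ p) (\<lambda>w. poly (P n) w / w ^ n * exp (- N_fun V w) - 1) z)
         \<le> K * ln (real n) / real n ^ (2 * k))"
proof (intro allI impI)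
  fix p :: nat and \<rho> :: real assume \<rho>: "\<rho> > 1"
  \<comment> \<open>Half the distance from \<open>\<rho>\<close> to 1: discs of this radius around
    points with \<open>norm z \<ge> \<rho>\<close> stay in
    \<open>norm w \<ge> \<rho> - \<delta> > 1\<close>, where the estimate without derivatives
    holds.\<close>
  define \<delta> where "\<delta> = (\<rho> - 1) / 2"
  have \<delta>: "\<delta> > 0" "\<rho> - \<delta> > 1" using \<rho> by (auto simp: \<delta>_def field_simps)
  obtain K where K: "K \<ge> 0" "\<And>n z. n \<ge> 1 \<Longrightarrow> norm z \<ge> \<rho> - \<delta> \<Longrightarrow>
    norm (poly (P n) z / z ^ n * exp (- N_fun V z) - 1) \<le> K / real n ^ (2 * k)"
    using OPUC_exterior_estimate[OF assms(2,1,3) \<delta>(2)] by blast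
  \<comment> \<open>The first term is the constant from Cauchy's inequality; adding 1 makes it
    positive even if \<open>K = 0\<close>.\<close>
  define K' where "K' = fact p * K / \<delta> ^ p + 1"
  have "fact p * K / \<delta> ^ p \<ge> 0" using K(1) \<delta> by simp
  then have "K' > 0" by (simp add: K'_def)
  moreover have "\<forall>\<^sub>F n in sequentially. \<forall>z::complex. norm z \<ge> \<rho> \<longrightarrow>
       norm ((deriv ^^ p) (\<lambda>w. poly (P n) w / w ^ n * exp (- N_fun V w) - 1) z)
         \<le> K' * ln (real n) / real n ^ (2 * k)"
  \<comment> \<open>From \<open>n = 3\<close> on, \<open>n\<close> exceeds \<open>exp 1\<close>, so
    \<open>ln n \<ge> 1\<close> and a bound without the logarithm suffices.\<close>
  proof (rule eventually_sequentiallyI[of 3], intro allI impI)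
    fix n :: nat and z :: complex assume n: "3 \<le> n" and z: "\<rho> \<le> norm z"
    let ?E = "\<lambda>w. poly (P n) w / w ^ n * exp (- N_fun V w) - 1"
    have sub: "norm w \<ge> \<rho> - \<delta>" if "w \<in> cball z \<delta>" for w
      using that z norm_triangle_ineq2[of z w] by (auto simp: dist_norm)
    have hol: "?E holomorphic_on {z. norm z > 1}"
      using holomorphic_on_N_fun[OF assms(2,1)] by (intro holomorphic_intros) auto
    have hol': "?E holomorphic_on cball z \<delta>"
      by (rule holomorphic_on_subset[OF hol]) (use sub \<delta> in force)
    have "norm ((deriv ^^ p) ?E z) \<le> fact p * (K / real n ^ (2 * k)) / \<delta> ^ p"
    proof (rule Cauchy_inequality)
      show "?E holomorphic_on ball z \<delta>" by (rule holomorphic_on_subset[OF hol']) auto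
      show "continuous_on (cball z \<delta>) ?E" by (rule holomorphic_on_imp_continuous_on[OF hol'])
      show "norm (?E w) \<le> K / real n ^ (2 * k)" if "norm (z - w) = \<delta>" for w
        using that sub[of w] n by (intro K(2)) (auto simp: dist_norm)
    qed (use \<delta> in auto)
    also have "\<dots> = (fact p * K / \<delta> ^ p) / real n ^ (2 * k)" by simp
    also have "\<dots> \<le> K' * ln (real n) / real n ^ (2 * k)"
    proof (rule divide_right_mono)
      have "1 \<le> ln (real n)"
        using n exp_le by (subst ln_ge_iff) auto
      then have "K' * 1 \<le> K' * ln (real n)" using \<open>K' > 0\<close> by (intro mult_left_mono) auto
      then show "fact p * K / \<delta> ^ p \<le> K' * ln (real n)" by (simp add: K'_def)
    qed simp
    finally show "norm ((deriv ^^ p) ?E z) \<le> K' * ln (real n) / real n ^ (2 * k)" .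
  qed
  ultimately show "\<exists>K > 0. \<forall>\<^sub>F n in sequentially. \<forall>z::complex. norm z \<ge> \<rho> \<longrightarrow>
       norm ((deriv ^^ p) (\<lambda>w. poly (P n) w / w ^ n * exp (- N_fun V w) - 1) z)
         \<le> K * ln (real n) / real n ^ (2 * k)" by blast
qed

end
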